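(* Let $\mathcal{S}$ be a species (or a linear species). The weighted exponential generating series $S^r_{\mathcal{S}}$, $S^h_{\mathcal{S}}$, $S_{\mathcal{S}}$ of, respectively, $\mathcal{S}$-edge-decorated rooted hypertrees, $\mathcal{S}$-edge-decorated hollow hypertrees and $\mathcal{S}$-edge-decorated hypertrees have the following expressions: $$S^r_{\mathcal{S}}(x)= \frac{x}{t} + \frac{1}{t} \sum_{n \geq 2} \sum_{k=1}^{n-1} E_{\mathcal{S}}(k,n-1)\,(nt)^{k}\, \frac{x^n}{n!},$$ $$S^h_{\mathcal{S}}(x)= \sum_{n \geq 1} \sum_{k=1}^{n} E_{\mathcal{S}}(k,n)\,(nt)^{k-1}\, \frac{x^n}{n!},$$ $$S_{\mathcal{S}}(x)= \frac{x}{t} + \sum_{n \geq 2} \sum_{k=1}^{n-1} E_{\mathcal{S}}(k,n-1)\,(nt)^{k-1}\, \frac{x^n}{n!},$$ where $E_{\mathcal{S}}(k,n)$ is the number of sets of $k$ sets on $n$ vertices (partitions of $\{1,\dots,n\}$ into $k$ non-empty blocks) with an $\mathcal{S}'$-structure on each of them, and where, by convention, $E_{\mathcal{S}}(1,1)$ is chosen to be equal to $1$. The generating series $S^{re}_{\mathcal{S}}$ and $S^e_{\mathcal{S}}$ of $\mathcal{S}$-edge-decorated edge-pointed rooted hypertrees and of $\mathcal{S}$-edge-decorated edge-pointed hypertrees are related to the previous ones by $$S^{re}_{\mathcal{S}}(x)= t\, S^r_{\mathcal{S}}(x)\times S^h_{\mathcal{S}}(x),\qquad S^e_{\mathcal{S}}(x)=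 S_{\mathcal{S}}(x)+S^{re}_{\mathcal{S}}(x)-S^r_{\mathcal{S}}(x).$$ These formulas give the cardinality of all types of decorated hypertrees in terms of decorated sets.
   Context: A hypergraph on a finite set $V$ is a pair $(V,E)$ with $E$ a set of subsets of $V$ of cardinality at least two (the edges). A hypertree on $V$ is a hypergraph with $V\neq\emptyset$ in which any two vertices are joined by one and only one walk with distinct edges; equivalently, the bipartite incidence graph (vertex set $V\sqcup E$, $v$ adjacent to $e$ iff $v\in e$) is a tree. The one-vertex hypergraph without edges is a hypertree. A rooted hypertree is a hypertree with a distinguished vertex; an edge-pointed hypertree has a distinguished edge; an edge-pointed rooted hypertree has a distinguished edge together with a distinguished vertex of that edge. A hollow hypertree on $I$ is a hypertree on $\{\#\}\sqcup I$ such that the vertex $\#$ (the gap) belongs to exactly one edge. A species is a functor from finite sets and bijections to finite sets; a linear species is such a functor to (finite-dimensional) vector spaces. The differential of $F$ is $F'(I)=F(I\sqcup\{\bullet\})$. An $\mathcal{S}$-edge-decorated (rooted, edge-pointed, edge-pointed rooted, hollow) hypertree is such a hypertree together with, for every edge $e$, an element of $\mathcal{S}(V_e)$, where $V_e$ is the set of vertices in $e$ (including the gap if it lies in $e$). For a linear species the decoration is multilinear (the space of structures is $\bigoplus_H\bigotimes_e \mathcal{S}(V_e)$) and cardinalities are replaced by dimensions. Each hypertree with edge set $E$ (rooted, pointed, hollow or not) has weight $t^{|E|-1}$, $t$ a formal variable. The weighted generating series is $\sum_{n\ge 0} a_n(t)\,x^n/n!$, where $a_n(t)$ is the sum of the weights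 of all structures of the given type on $\{1,\dots,n\}$ (for hollow hypertrees, on $\{\#\}\sqcup\{1,\dots,n\}$).
   Formalization: The convention E_S(1,1)=1 is not imposed: E_S(1,1) is the true count (dimension) of S({1,2}). Setting it to 1 makes the formulas false at n=2 when S({1,2}) does not have exactly one structure; when it has, the two agree. *)

theory Defs
  imports
    "HOL-Computational_Algebra.Formal_Laurent_Series"
    "HOL-Library.Function_Algebras"
    "HOL-Library.FuncSet"
    "HOL-Library.Disjoint_Sets"
begin

section \<open>Hypertrees\<close>

text \<open>
  A walk is a start vertex \<open>u\<close> followed by a list of steps (edge, next vertex); consecutive
  vertices are distinct, since otherwise uniqueness of walks would fail for every nonempty edge.
\<close>

fun hwalk :: "'v set set \<Rightarrow> 'v \<Rightarrow> ('v set \<times> 'v) list \<Rightarrow> 'v \<Rightarrow> bool" where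
  "hwalk E u [] w \<longleftrightarrow> u = w"
| "hwalk E u ((e, v) # p) w \<longleftrightarrow> e \<in> E \<and> u \<in> e \<and> v \<in> e \<and> u \<noteq> v \<and> hwalk E v p w"

definition hypergraph :: "'v set \<Rightarrow> 'v set set \<Rightarrow> bool" where
  "hypergraph V E \<longleftrightarrow> finite V \<and> (\<forall>e\<in>E. e \<subseteq> V \<and> 2 \<le> card e)"

definition hypertree :: "'v set \<Rightarrow> 'v set set \<Rightarrow> bool" where
  "hypertree V E \<longleftrightarrow> hypergraph V E \<and> V \<noteq> {} \<and>
     (\<forall>u\<in>V. \<forall>w\<in>V. \<exists>!p. hwalk E u p w \<and> distinct (map fst p))"

definition hypertrees :: "'v set \<Rightarrow> 'v set set set" where
  "hypertrees V = {E. hypertree V E}"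

definition rooted_hypertrees :: "'v set \<Rightarrow> ('v set set \<times> 'v) set" where
  "rooted_hypertrees V = {(E, r). hypertree V E \<and> r \<in> V}"

definition edge_pointed_hypertrees :: "'v set \<Rightarrow> ('v set set \<times> 'v set) set" where
  "edge_pointed_hypertrees V = {(E, e). hypertree V E \<and> e \<in> E}"

definition edge_pointed_rooted_hypertrees :: "'v set \<Rightarrow> ('v set set \<times> 'v set \<times> 'v) set" where
  "edge_pointed_rooted_hypertrees V = {(E, e, r). hypertree V E \<and> e \<in> E \<and> r \<in> e}"

text \<open>The gap \<open>g\<close> is meant to be an element outside \<open>I\<close>.\<close>

definition hollow_hypertrees :: "'v \<Rightarrow> 'v set \<Rightarrow> 'v set set set" where
  "hollow_hypertrees g I = {E. hypertree (insert g I) E \<and> (\<exists>!e. e \<in> E \<and> g \<in> e)}"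


section \<open>Species\<close>

text \<open>
  Species are given on the finite subsets of \<^typ>\<open>nat\<close>, a full subcategory equivalent to that of
  all finite sets and bijections. The bijection \<open>I \<rightarrow> \<sigma> ` I\<close> induced by a map \<open>\<sigma>\<close> injective on \<open>I\<close>
  acts by \<open>tr I \<sigma>\<close>, which depends only on the values of \<open>\<sigma>\<close> on \<open>I\<close>.
\<close>

locale species =
  fixes S :: "nat set \<Rightarrow> 'a set"
    and tr :: "nat set \<Rightarrow> (nat \<Rightarrow> nat) \<Rightarrow> 'a \<Rightarrow> 'a"
  assumes finite_structures: "finite I \<Longrightarrow> finite (S I)"
    and tr_closed: "finite I \<Longrightarrow> inj_on \<sigma> I \<Longrightarrow> x \<in> S I \<Longrightarrow> tr I \<sigma> x \<in> S (\<sigma> ` I)"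
    and tr_cong: "finite I \<Longrightarrow> inj_on \<sigma> I \<Longrightarrow> (\<And>i. i \<in> I \<Longrightarrow> \<sigma> i = \<tau> i) \<Longrightarrow> x \<in> S I
                   \<Longrightarrow> tr I \<sigma> x = tr I \<tau> x"
    and tr_id: "finite I \<Longrightarrow> x \<in> S I \<Longrightarrow> tr I id x = x"
    and tr_comp: "finite I \<Longrightarrow> inj_on \<sigma> I \<Longrightarrow> inj_on \<tau> (\<sigma> ` I) \<Longrightarrow> x \<in> S I
                   \<Longrightarrow> tr I (\<tau> \<circ> \<sigma>) x = tr (\<sigma> ` I) \<tau> (tr I \<sigma> x)"

text \<open>
  The values of a linear species are finite-dimensional subspaces of a common vector space over
  a field; every functor on the finite subsets of \<^typ>\<open>nat\<close> can be put in this form (take the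
  direct sum of its values as the ambient space).
\<close>

locale linear_species = vector_space scale
  for scale :: "'k::field \<Rightarrow> 'b::ab_group_add \<Rightarrow> 'b" +
  fixes S :: "nat set \<Rightarrow> 'b set"
    and tr :: "nat set \<Rightarrow> (nat \<Rightarrow> nat) \<Rightarrow> 'b \<Rightarrow> 'b"
  assumes finite_dim: "finite I \<Longrightarrow> \<exists>B. finite B \<and> span B = S I"
    and tr_closed: "finite I \<Longrightarrow> inj_on \<sigma> I \<Longrightarrow> x \<in> S I \<Longrightarrow> tr I \<sigma> x \<in> S (\<sigma> ` I)"
    and tr_add: "finite I \<Longrightarrow> inj_on \<sigma> I \<Longrightarrow> x \<in> S I \<Longrightarrow> y \<in> S I
                   \<Longrightarrow> tr I \<sigma> (x + y) = tr I \<sigma> x + tr I \<sigma> y"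
    and tr_scale: "finite I \<Longrightarrow> inj_on \<sigma> I \<Longrightarrow> x \<in> S I
                   \<Longrightarrow> tr I \<sigma> (scale c x) = scale c (tr I \<sigma> x)"
    and tr_cong: "finite I \<Longrightarrow> inj_on \<sigma> I \<Longrightarrow> (\<And>i. i \<in> I \<Longrightarrow> \<sigma> i = \<tau> i) \<Longrightarrow> x \<in> S I
                   \<Longrightarrow> tr I \<sigma> x = tr I \<tau> x"
    and tr_id: "finite I \<Longrightarrow> x \<in> S I \<Longrightarrow> tr I id x = x"
    and tr_comp: "finite I \<Longrightarrow> inj_on \<sigma> I \<Longrightarrow> inj_on \<tau> (\<sigma> ` I) \<Longrightarrow> x \<in> S I
                   \<Longrightarrow> tr I (\<tau> \<circ> \<sigma>) x = tr (\<sigma> ` I) \<tau> (tr I \<sigma> x)"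

text \<open>
  The differential (on objects): the disjoint union of \<open>I\<close> with a new point is realised in
  \<^typ>\<open>nat\<close> by shifting \<open>I\<close> up by one and adding \<open>0\<close>.
\<close>

definition differential :: "(nat set \<Rightarrow> 'a set) \<Rightarrow> nat set \<Rightarrow> 'a set" where
  "differential S I = S (insert 0 (Suc ` I))"


section \<open>Decorated structures\<close>

text \<open>
  Throughout, \<open>X\<close> is a set of combinatorial structures (pointed hypertrees, partitions) and
  \<open>ed h\<close> is the set of those subsets (edges, blocks) carried by \<open>h \<in> X\<close> that get decorated.
\<close>

definition decorated ::
    "(nat set \<Rightarrow> 'a set) \<Rightarrow> ('h \<Rightarrow> nat set set) \<Rightarrow> 'h set \<Rightarrow> ('h \<times> (nat set \<Rightarrow> 'a)) set" where
  "decorated S ed X = (SIGMA h:X. PiE (ed h) S)"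

text \<open>
  In the linear case, the tensor product of the spaces \<open>S e\<close>, \<open>e \<in> E\<close>, is realised as the span of
  the pure tensors, a pure tensor being the evaluation of multilinear forms at a family of vectors.
  Over a field multilinear forms separate the elements of the tensor product, so this is
  a faithful model of it (in particular it is one-dimensional for \<open>E = {}\<close>).
\<close>

definition multilinear_form ::
    "('k::field \<Rightarrow> 'b::ab_group_add \<Rightarrow> 'b) \<Rightarrow> (nat set \<Rightarrow> 'b set) \<Rightarrow> nat set set
      \<Rightarrow> ((nat set \<Rightarrow> 'b) \<Rightarrow> 'k) \<Rightarrow> bool" where
  "multilinear_form scale S E \<phi> \<longleftrightarrow>
     (\<forall>d\<in>PiE E S. \<forall>e\<in>E. \<forall>x\<in>S e. \<forall>y\<in>S e. \<forall>c.
        \<phi> (d(e := x + y)) = \<phi> (d(e := x)) + \<phi> (d(e := y)) \<and>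
        \<phi> (d(e := scale c x)) = c * \<phi> (d(e := x)))"

definition pure_tensor ::
    "('k::field \<Rightarrow> 'b::ab_group_add \<Rightarrow> 'b) \<Rightarrow> (nat set \<Rightarrow> 'b set) \<Rightarrow> nat set set
      \<Rightarrow> (nat set \<Rightarrow> 'b) \<Rightarrow> ((nat set \<Rightarrow> 'b) \<Rightarrow> 'k) \<Rightarrow> 'k" where
  "pure_tensor scale S E d = (\<lambda>\<phi>. if multilinear_form scale S E \<phi> then \<phi> d else 0)"

definition tensor_space ::
    "('k::field \<Rightarrow> 'b::ab_group_add \<Rightarrow> 'b) \<Rightarrow> (nat set \<Rightarrow> 'b set) \<Rightarrow> nat set set
      \<Rightarrow> (((nat set \<Rightarrow> 'b) \<Rightarrow> 'k) \<Rightarrow> 'k) set" where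
  "tensor_space scale S E =
     module.span (\<lambda>c u \<phi>. c * u \<phi>) (pure_tensor scale S E ` PiE E S)"

text \<open>The direct sum over \<open>X\<close> of the tensor products; only finite \<open>X\<close> are used.\<close>

definition decorated_space ::
    "('k::field \<Rightarrow> 'b::ab_group_add \<Rightarrow> 'b) \<Rightarrow> (nat set \<Rightarrow> 'b set) \<Rightarrow> ('h \<Rightarrow> nat set set)
      \<Rightarrow> 'h set \<Rightarrow> ('h \<Rightarrow> ((nat set \<Rightarrow> 'b) \<Rightarrow> 'k) \<Rightarrow> 'k) set" where
  "decorated_space scale S ed X =
     {f. (\<forall>h\<in>X. f h \<in> tensor_space scale S (ed h)) \<and> (\<forall>h. h \<notin> X \<longrightarrow> f h = 0)}"

definition decorated_dim ::
    "('k::field \<Rightarrow> 'b::ab_group_add \<Rightarrow> 'b) \<Rightarrow> (nat set \<Rightarrow> 'b set) \<Rightarrow> ('h \<Rightarrow> nat set set)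
      \<Rightarrow> 'h set \<Rightarrow> nat" where
  "decorated_dim scale S ed X =
     vector_space.dim (\<lambda>c f h \<phi>. c * f h \<phi>) (decorated_space scale S ed X)"


section \<open>Weighted generating series\<close>

text \<open>
  Series are power series in \<open>x\<close> over the field of formal Laurent series in \<open>t\<close>
  (the weight of the one-vertex hypertree is \<open>t\<close> to the power \<open>-1\<close>).
\<close>

abbreviation t :: "rat fls" where
  "t \<equiv> fls_X"

definition weight :: "nat \<Rightarrow> rat fls" where
  "weight m = t powi (int m - 1)"

definition weighted_egf ::
    "(nat set \<Rightarrow> 'a set) \<Rightarrow> ('h \<Rightarrow> nat set set) \<Rightarrow> (nat \<Rightarrow> 'h set) \<Rightarrow> rat fls fps" where
  "weighted_egf S ed X =
     Abs_fps (\<lambda>n. (\<Sum>(h, d) \<in> decorated S ed (X n). weight (card (ed h))) / fact n)"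

text \<open>In the linear case the space of structures is graded by the number of edges.\<close>

definition weighted_egf_lin ::
    "('k::field \<Rightarrow> 'b::ab_group_add \<Rightarrow> 'b) \<Rightarrow> (nat set \<Rightarrow> 'b set) \<Rightarrow> ('h \<Rightarrow> nat set set)
      \<Rightarrow> (nat \<Rightarrow> 'h set) \<Rightarrow> rat fls fps" where
  "weighted_egf_lin scale S ed X =
     Abs_fps (\<lambda>n. (\<Sum>m \<in> (\<lambda>h. card (ed h)) ` X n.
        of_nat (decorated_dim scale S ed {h \<in> X n. card (ed h) = m}) * weight m) / fact n)"

definition "ser_hyp S = weighted_egf S id (\<lambda>n. hypertrees {1..n})"
definition "ser_r S = weighted_egf S fst (\<lambda>n. rooted_hypertrees {1..n})"
definition "ser_e S = weighted_egf S fst (\<lambda>n. edge_pointed_hypertrees {1..n})"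
definition "ser_re S = weighted_egf S fst (\<lambda>n. edge_pointed_rooted_hypertrees {1..n})"
definition "ser_h S = weighted_egf S id (\<lambda>n. hollow_hypertrees 0 {1..n})"

definition "lin_ser_hyp scale S = weighted_egf_lin scale S id (\<lambda>n. hypertrees {1..n})"
definition "lin_ser_r scale S = weighted_egf_lin scale S fst (\<lambda>n. rooted_hypertrees {1..n})"
definition "lin_ser_e scale S = weighted_egf_lin scale S fst (\<lambda>n. edge_pointed_hypertrees {1..n})"
definition "lin_ser_re scale S =
  weighted_egf_lin scale S fst (\<lambda>n. edge_pointed_rooted_hypertrees {1..n})"
definition "lin_ser_h scale S = weighted_egf_lin scale S id (\<lambda>n. hollow_hypertrees 0 {1..n})"


section \<open>Decorated sets of sets\<close>

text \<open>
  \<open>E_num\<close> and \<open>E_dim\<close> are the actual numbers (dimensions) for all \<open>k\<close> and \<open>n\<close>. The convention that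
  the value at \<open>(1, 1)\<close> is \<open>1\<close> is not imposed by overriding that value: the formulas for two-vertex
  hypertrees would fail for species not having exactly one structure on two-element sets.
\<close>

definition set_partitions :: "nat \<Rightarrow> nat \<Rightarrow> nat set set set" where
  "set_partitions k n = {P. partition_on {1..n} P \<and> card P = k}"

definition E_num :: "(nat set \<Rightarrow> 'a set) \<Rightarrow> nat \<Rightarrow> nat \<Rightarrow> nat" where
  "E_num S k n = card (decorated (differential S) id (set_partitions k n))"

definition E_dim ::
    "('k::field \<Rightarrow> 'b::ab_group_add \<Rightarrow> 'b) \<Rightarrow> (nat set \<Rightarrow> 'b set) \<Rightarrow> nat \<Rightarrow> nat \<Rightarrow> nat" where
  "E_dim scale S k n = decorated_dim scale (differential S) id (set_partitions k n)"

end

theory Submission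
  imports Defs
begin

text \<open>
  Root a hypertree on \<open>V\<close> at a vertex \<open>r\<close>. Each edge \<open>e\<close> has a unique vertex \<open>p\<close> closest to \<open>r\<close>;
  the blocks \<open>e - {p}\<close> form a partition of \<open>V - {r}\<close>, and the hypertree is recovered from this
  partition together with the acyclic map sending each block to its \<open>p\<close>. A decoration of \<open>e\<close>
  is the same as a structure of the differential on its block, so only the number of acyclic maps
  matters. With root set \<open>R\<close> and \<open>n\<close> vertices in all it is \<open>|R| n^(k-1)\<close> for \<open>k\<close> blocks: classify
  the maps by the set of blocks attached directly to \<open>R\<close> and use induction. Taking \<open>|R| = 1\<close> gives the
  series of hypertrees; summing over the block attached to the gap gives hollow hypertrees.

  The product formula for edge-pointed rooted hypertrees is proved for a fixed partition: cutting the
  pointed edge off its root makes its block a second root set, and the blocks split according to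
  the root set they descend from. The last relation follows from the incidence count
  \<open>\<Sum>|e| = |V| + |E| - 1\<close>.

  In the linear case all spaces are replaced by bases: pure tensors of basis vectors form a basis
  of a tensor space, since products of coordinate functionals are multilinear forms dual to them.
\<close>

section \<open>Counting acyclic parent maps\<close>

text \<open>The induction needs arbitrary root sets, because once a family \<open>Q\<close> of
  blocks hangs on \<open>R\<close>, the other blocks see \<open>\<Union>Q\<close> as their roots. It
  closes because these new roots and the remaining blocks together always make up
  \<open>\<Union>P\<close>, whatever \<open>Q\<close> is. With \<open>m = card R\<close> and
  \<open>N = card (\<Union>P)\<close> one sums
  \<open>m ^ card Q * N ^ card (P - Q) * card (\<Union>Q)\<close>, divided by \<open>N\<close>, and
  the binomial theorem collapses this to \<open>m * (m + N) ^ (card P - 1)\<close>. Acyclicity in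
  terms of sets of blocks is used in two ways: for the blocks not yet attached it yields the next
  edge to add, and for a set of bad blocks it yields a minimal counterexample. Decorations are
  counted by a function \<open>w\<close> of the size of an edge alone. Hence arbitrary bases of a
  linear species can serve as its sets of structures, although they need not be compatible with
  transport. The factor \<open>t\<close> in the product formula and the terms \<open>x/t\<close>
  both come from the \<open>- 1\<close> in the exponent of the weight.\<close>

lemma card_extensional_split:
  assumes "Q \<subseteq> P" "X \<subseteq> extensional Q" "Y \<subseteq> extensional (P - Q)"
  shows "card {p \<in> extensional P. restrict p Q \<in> X \<and> restrict p (P - Q) \<in> Y} = card X * card Y"
proof -
  have "bij_betw (\<lambda>p. (restrict p Q, restrict p (P - Q)))
      {p \<in> extensional P. restrict p Q \<in> X \<and> restrict p (P - Q) \<in> Y} (X \<times> Y)"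
  proof (rule bij_betwI[where g = "\<lambda>(f, g). \<lambda>B. if B \<in> Q then f B else g B"])
    have *: "restrict (\<lambda>B. if B \<in> Q then f B else g B) Q = f"
      "restrict (\<lambda>B. if B \<in> Q then f B else g B) (P - Q) = g"
      if "f \<in> X" "g \<in> Y" for f g
      using that assms by (auto simp: fun_eq_iff extensional_def restrict_def subset_iff)
    show "(\<lambda>(f, g). \<lambda>B. if B \<in> Q then f B else g B) \<in>
        X \<times> Y \<rightarrow> {p \<in> extensional P. restrict p Q \<in> X \<and> restrict p (P - Q) \<in> Y}"
      using assms(1) subsetD[OF assms(2)] subsetD[OF assms(3)] * by (force simp: extensional_def)
    show "(\<lambda>p. (restrict p Q, restrict p (P - Q)))
        ((\<lambda>(f, g). \<lambda>B. if B \<in> Q then f B else g B) y) = y" if "y \<in> X \<times> Y" for y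
      using that * by auto
    show "(\<lambda>p. (restrict p Q, restrict p (P - Q)))
        \<in> {p \<in> extensional P. restrict p Q \<in> X \<and> restrict p (P - Q) \<in> Y} \<rightarrow> X \<times> Y"
      by auto
    show "(\<lambda>(f, g). \<lambda>B. if B \<in> Q then f B else g B) (restrict p Q, restrict p (P - Q)) = p"
      if "p \<in> {p \<in> extensional P. restrict p Q \<in> X \<and> restrict p (P - Q) \<in> Y}" for p
    proof -
      have "(if B \<in> Q then restrict p Q B else restrict p (P - Q) B) = p B" for B
        using that assms(1) extensional_arb[of p P B] by auto
      then show ?thesis by simp
    qed
  qed
  then show ?thesis
    using bij_betw_same_card card_cartesian_product by fastforce
qed

text \<open>
  \<open>P\<close> is a family of disjoint blocks and \<open>R\<close> the set of roots. Acyclicity is expressed by the absence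
  of a nonempty set of blocks whose parents all lie in these blocks.
\<close>

definition acyclic_maps :: "'v set set \<Rightarrow> 'v set \<Rightarrow> ('v set \<Rightarrow> 'v) set" where
  "acyclic_maps P R =
     {p \<in> P \<rightarrow>\<^sub>E R \<union> \<Union>P. \<forall>Q\<subseteq>P. Q \<noteq> {} \<longrightarrow> (\<exists>B\<in>Q. p B \<notin> \<Union>Q)}"

lemma acyclic_mapsD:
  assumes "p \<in> acyclic_maps P R"
  shows "p \<in> extensional P" "B \<in> P \<Longrightarrow> p B \<in> R \<union> \<Union>P"
    "Q \<subseteq> P \<Longrightarrow> Q \<noteq> {} \<Longrightarrow> \<exists>B\<in>Q. p B \<notin> \<Union>Q"
  using assms unfolding acyclic_maps_def by (simp_all add: PiE_iff)

lemma acyclic_maps_empty [simp]: "acyclic_maps {} R = {\<lambda>_. undefined}"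
  by (simp add: acyclic_maps_def)

lemma finite_acyclic_maps: "finite P \<Longrightarrow> finite R \<Longrightarrow> (\<And>B. B \<in> P \<Longrightarrow> finite B) \<Longrightarrow> finite (acyclic_maps P R)"
  by (rule finite_subset[of _ "P \<rightarrow>\<^sub>E R \<union> \<Union>P"])
    (simp_all add: acyclic_maps_def finite_PiE)

text \<open>Parents of blocks of \<open>Q\<close> never lie in other blocks, so a bad set of blocks
  meeting \<open>Q\<close> is already bad inside \<open>Q\<close>; one that misses \<open>Q\<close>
  is bad for \<open>P - Q\<close>, where the vertices of \<open>Q\<close> act as roots. The two sets
  \<open>R1\<close> and \<open>R2\<close> serve two uses: \<open>R1 = R\<close>,
  \<open>R2 = {}\<close> for the blocks attached directly to the roots, and two disjoint root sets
  for splitting by descent.\<close>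

lemma acyclic_maps_glue_iff:
  assumes P: "disjoint P" and Q: "Q \<subseteq> P" and p: "p \<in> extensional P"
    and dom: "\<And>B. B \<in> Q \<Longrightarrow> p B \<in> R1 \<union> \<Union>Q" "\<And>B. B \<in> P - Q \<Longrightarrow> p B \<in> R2 \<union> \<Union>P"
    and R: "R1 \<inter> \<Union>P = {}" "R2 \<inter> \<Union>P = {}" "R1 \<union> R2 = R"
  shows "p \<in> acyclic_maps P R \<longleftrightarrow>
     restrict p Q \<in> acyclic_maps Q R1 \<and> restrict p (P - Q) \<in> acyclic_maps (P - Q) (R2 \<union> \<Union>Q)"
proof (intro iffI conjI)
  assume p': "p \<in> acyclic_maps P R"
  have 1: "\<exists>B\<in>X. p B \<notin> \<Union>X" if "X \<subseteq> P" "X \<noteq> {}" for X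
    using acyclic_mapsD(3)[OF p'] that by blast
  show "restrict p Q \<in> acyclic_maps Q R1"
    unfolding acyclic_maps_def
  proof (intro CollectI conjI allI impI)
    show "restrict p Q \<in> Q \<rightarrow>\<^sub>E R1 \<union> \<Union>Q" using dom by auto
    fix X assume "X \<subseteq> Q" "X \<noteq> {}"
    then show "\<exists>B\<in>X. restrict p Q B \<notin> \<Union>X" using 1[of X] Q by (auto simp: subset_iff)
  qed
  have "\<Union>P = \<Union>Q \<union> \<Union>(P - Q)" using Q by auto
  show "restrict p (P - Q) \<in> acyclic_maps (P - Q) (R2 \<union> \<Union>Q)"
    unfolding acyclic_maps_def
  proof (intro CollectI conjI allI impI)
    show "restrict p (P - Q) \<in> P - Q \<rightarrow>\<^sub>E R2 \<union> \<Union>Q \<union> \<Union>(P - Q)"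
      using dom(2) \<open>\<Union>P = _\<close> by auto
    fix X assume "X \<subseteq> P - Q" "X \<noteq> {}"
    then show "\<exists>B\<in>X. restrict p (P - Q) B \<notin> \<Union>X" using 1[of X] by (auto simp: subset_iff)
  qed
next
  assume *: "restrict p Q \<in> acyclic_maps Q R1 \<and>
     restrict p (P - Q) \<in> acyclic_maps (P - Q) (R2 \<union> \<Union>Q)"
  show "p \<in> acyclic_maps P R"
    unfolding acyclic_maps_def
  proof (intro CollectI conjI allI impI)
    have "p B \<in> R \<union> \<Union>P" if "B \<in> P" for B
      using dom[of B] R that Q by (cases "B \<in> Q") auto
    then show "p \<in> P \<rightarrow>\<^sub>E R \<union> \<Union>P" using p by (auto simp: PiE_def)
    fix X assume X: "X \<subseteq> P" "X \<noteq> {}"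
    show "\<exists>B\<in>X. p B \<notin> \<Union>X"
    proof (cases "X \<inter> Q = {}")
      case True
      then have "X \<subseteq> P - Q" using X by auto
      then obtain B where "B \<in> X" "restrict p (P - Q) B \<notin> \<Union>X"
        using acyclic_mapsD(3)[OF conjunct2[OF *]] X by metis
      then show ?thesis using \<open>X \<subseteq> P - Q\<close> by (intro bexI[of _ B]) auto
    next
      case False
      then obtain B where B: "B \<in> X \<inter> Q" "restrict p Q B \<notin> \<Union>(X \<inter> Q)"
        using acyclic_mapsD(3)[OF conjunct1[OF *], of "X \<inter> Q"] by auto
      \<comment> \<open>A block \<open>C\<close> of \<open>X\<close> containing \<open>p B\<close>
        would lie outside \<open>Q\<close> by the choice of \<open>B\<close>, whereas the condition
        on \<open>Q\<close> puts \<open>p B\<close> into a block of \<open>Q\<close>; disjoint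
        blocks exclude this.\<close>
      have "p B \<notin> C" if "C \<in> X" for C
      proof
        assume C: "p B \<in> C"
        have "C \<notin> Q" using B C that by auto
        moreover have "p B \<in> \<Union>P" using C that X by auto
        then have "p B \<in> \<Union>Q" using dom(1)[of B] B R(1) by auto
        then obtain D where "D \<in> Q" "p B \<in> D" by auto
        ultimately show False
          using disjointD[OF P, of C D] that X Q C by auto
      qed
      then show ?thesis using B by auto
    qed
  qed
qed

lemma acyclic_maps_to_roots:
  assumes "R \<inter> \<Union>P = {}" "p \<in> P \<rightarrow>\<^sub>E R"
  shows "p \<in> acyclic_maps P R"
  unfolding acyclic_maps_def
proof (intro CollectI conjI allI impI)
  show "p \<in> P \<rightarrow>\<^sub>E R \<union> \<Union>P" using assms by auto
  fix Q assume "Q \<subseteq> P" "Q \<noteq> {}"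
  then obtain B where "B \<in> Q" "p B \<in> R" using assms(2) by (auto simp: PiE_iff)
  then show "\<exists>B\<in>Q. p B \<notin> \<Union>Q" using assms(1) \<open>Q \<subseteq> P\<close> by (intro bexI[of _ B]) auto
qed

text \<open>One fibre of the classification by first layer: the blocks of \<open>Q\<close> choose
  their parents in \<open>R\<close> independently, and the others form an acyclic map over the root
  set \<open>\<Union>Q\<close>.\<close>

lemma card_acyclic_maps_layer:
  assumes P: "disjoint P" "R \<inter> \<Union>P = {}" and Q: "Q \<subseteq> P" "finite P"
  shows "card {p \<in> acyclic_maps P R. {B \<in> P. p B \<in> R} = Q} =
    card R ^ card Q * card (acyclic_maps (P - Q) (\<Union>Q))"
proof -
  have "{p \<in> acyclic_maps P R. {B \<in> P. p B \<in> R} = Q} =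
    {p \<in> extensional P. restrict p Q \<in> Q \<rightarrow>\<^sub>E R \<and> restrict p (P - Q) \<in> acyclic_maps (P - Q) (\<Union>Q)}"
    (is "?L = ?R")
  proof (intro set_eqI iffI)
    fix p assume p: "p \<in> ?L"
    have "restrict p Q \<in> Q \<rightarrow>\<^sub>E R" using p by auto
    moreover have "restrict p (P - Q) \<in> acyclic_maps (P - Q) ({} \<union> \<Union>Q)"
      by (rule conjunct2[OF acyclic_maps_glue_iff[THEN iffD1, of P Q p R "{}" R]])
        (use p P Q acyclic_mapsD[of p P R] in auto)
    ultimately show "p \<in> ?R" using p by (auto dest: acyclic_mapsD)
  next
    fix p assume p: "p \<in> ?R"
    have pQ: "p B \<in> R" if "B \<in> Q" for B using p that by (auto simp: PiE_iff)
    have pP: "p B \<in> \<Union>P" if "B \<in> P - Q" for B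
      using acyclic_mapsD(2)[of "restrict p (P - Q)" "P - Q" "\<Union>Q" B] p that Q by auto
    have "restrict p Q \<in> acyclic_maps Q R"
      using p P Q by (intro acyclic_maps_to_roots) auto
    then have "p \<in> acyclic_maps P R"
      by (intro acyclic_maps_glue_iff[THEN iffD2, of P Q p R "{}" R])
        (use p P Q pQ pP in auto)
    then show "p \<in> ?L" using pQ pP P Q by fastforce
  qed
  also have "card \<dots> = card (Q \<rightarrow>\<^sub>E R) * card (acyclic_maps (P - Q) (\<Union>Q))"
    by (rule card_extensional_split) (use Q in \<open>auto simp: PiE_iff dest: acyclic_mapsD\<close>)
  also have "card (Q \<rightarrow>\<^sub>E R) = card R ^ card Q"
    using Q finite_subset by (subst card_PiE) auto
  finally show ?thesis .
qed

text \<open>Following parents from a block ends in exactly one of the two root sets.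
  \<open>Q\<close> collects the blocks that descend from \<open>R1\<close>, and no parent leads from
  \<open>Q\<close> to its complement or back.\<close>

lemma card_acyclic_maps_split:
  assumes P: "disjoint P" "finite P" "\<And>B. B \<in> P \<Longrightarrow> finite B" and R: "finite R1" "finite R2"
    "R1 \<inter> R2 = {}" "R1 \<inter> \<Union>P = {}" "R2 \<inter> \<Union>P = {}"
  shows "card (acyclic_maps P (R1 \<union> R2)) =
    (\<Sum>Q\<in>Pow P. card (acyclic_maps Q R1) * card (acyclic_maps (P - Q) R2))"
proof -
  define C where "C = (\<lambda>Q. {p \<in> acyclic_maps P (R1 \<union> R2).
    (\<forall>B\<in>Q. p B \<in> R1 \<union> \<Union>Q) \<and> (\<forall>B\<in>P - Q. p B \<in> R2 \<union> \<Union>(P - Q))})"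
  have 1: "acyclic_maps P (R1 \<union> R2) = (\<Union>Q\<in>Pow P. C Q)"
  proof -
    have "\<exists>Q\<in>Pow P. p \<in> C Q" if p: "p \<in> acyclic_maps P (R1 \<union> R2)" for p
    proof -
      \<comment> \<open>The union of \<open>F\<close> is the largest set of blocks closed under
        parents up to \<open>R1\<close>, which avoids iterating the parent map. By maximality a
        block outside it cannot have its parent in \<open>R1\<close> or in the union, so the
        complement is closed up to \<open>R2\<close>.\<close>
      define F where "F = {Q. Q \<subseteq> P \<and> (\<forall>B\<in>Q. p B \<in> R1 \<union> \<Union>Q)}"
      have F: "X \<in> F \<longleftrightarrow> X \<subseteq> P \<and> (\<forall>B\<in>X. p B \<in> R1 \<union> \<Union>X)" for X
        by (simp add: F_def)
      have Q: "\<Union>F \<subseteq> P" "\<And>B. B \<in> \<Union>F \<Longrightarrow> p B \<in> R1 \<union> \<Union>(\<Union>F)"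
        using F by blast+
      have "p B \<in> R2 \<union> \<Union>(P - \<Union>F)" if B: "B \<in> P - \<Union>F" for B
      proof (rule ccontr)
        assume "p B \<notin> R2 \<union> \<Union>(P - \<Union>F)"
        then have "p B \<in> R1 \<union> \<Union>(\<Union>F)" using acyclic_mapsD(2)[OF p, of B] B by blast
        then have "p C \<in> R1 \<union> \<Union>(insert B (\<Union>F))" if "C \<in> insert B (\<Union>F)" for C
          using Q(2)[of C] that by auto
        then have "\<forall>C\<in>insert B (\<Union>F). p C \<in> R1 \<union> \<Union>(insert B (\<Union>F))" by blast
        moreover have "insert B (\<Union>F) \<subseteq> P" using B Q(1) by blast
        ultimately have "insert B (\<Union>F) \<in> F" using F by blast
        then show False using B by blast
      qed
      then have "p \<in> C (\<Union>F)" using p Q(2) unfolding C_def by auto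
      then show ?thesis using Q(1) by auto
    qed
    then have "acyclic_maps P (R1 \<union> R2) \<subseteq> (\<Union>Q\<in>Pow P. C Q)"
      by (intro subsetI UN_iff[THEN iffD2])
    moreover have "(\<Union>Q\<in>Pow P. C Q) \<subseteq> acyclic_maps P (R1 \<union> R2)"
      unfolding C_def by (intro UN_least Collect_restrict)
    ultimately show ?thesis by (rule equalityI)
  qed
  \<comment> \<open>Uniqueness of the splitting: parents of blocks in \<open>Q - Q'\<close> stay in
    blocks of \<open>Q\<close> and in blocks outside \<open>Q'\<close>, so a nonempty
    \<open>Q - Q'\<close> would contain all its parents.\<close>
  have 2: "Q \<subseteq> Q'" if Q: "Q \<subseteq> P" "Q' \<subseteq> P" and p: "p \<in> C Q" "p \<in> C Q'" for Q Q' p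
  proof (rule ccontr)
    assume "\<not> Q \<subseteq> Q'"
    then obtain B where B: "B \<in> Q - Q'" "p B \<notin> \<Union>(Q - Q')"
      using acyclic_mapsD(3)[of p P "R1 \<union> R2" "Q - Q'"] p Q unfolding C_def by blast
    have "p B \<in> R1 \<union> \<Union>Q" "p B \<in> R2 \<union> \<Union>(P - Q')" using p B Q unfolding C_def by auto
    then obtain D D' where "D \<in> Q" "D' \<in> P - Q'" "p B \<in> D" "p B \<in> D'"
      using R Q by blast
    then have "D = D'" using disjointD[OF P(1), of D D'] Q by auto
    then show False using \<open>D \<in> Q\<close> \<open>D' \<in> P - Q'\<close> \<open>p B \<in> D\<close> B by auto
  qed
  have fin: "finite (acyclic_maps P (R1 \<union> R2))" using P R by (intro finite_acyclic_maps) auto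
  have "card (acyclic_maps P (R1 \<union> R2)) = (\<Sum>Q\<in>Pow P. card (C Q))"
    unfolding 1
  proof (rule card_UN_disjoint)
    show "\<forall>Q\<in>Pow P. finite (C Q)" using fin by (auto simp: C_def)
    show "\<forall>Q\<in>Pow P. \<forall>Q'\<in>Pow P. Q \<noteq> Q' \<longrightarrow> C Q \<inter> C Q' = {}" using 2 by blast
  qed (use P in auto)
  also have "\<dots> = (\<Sum>Q\<in>Pow P. card (acyclic_maps Q R1) * card (acyclic_maps (P - Q) R2))"
  proof (rule sum.cong[OF refl])
    fix Q assume Q: "Q \<in> Pow P"
    show "card (C Q) = card (acyclic_maps Q R1) * card (acyclic_maps (P - Q) R2)"
    proof -
    have "C Q = {p \<in> extensional P. restrict p Q \<in> acyclic_maps Q R1 \<and>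
        restrict p (P - Q) \<in> acyclic_maps (P - Q) R2}" (is "_ = ?R")
    proof (intro set_eqI iffI)
      fix p assume p: "p \<in> C Q"
      have "restrict p Q \<in> acyclic_maps Q R1 \<and> restrict p (P - Q) \<in> acyclic_maps (P - Q) (R2 \<union> \<Union>Q)"
        by (rule acyclic_maps_glue_iff[THEN iffD1, of P Q p R1 R2 "R1 \<union> R2"])
          (use p P Q R acyclic_mapsD(1)[of p P] in \<open>auto simp: C_def\<close>)
      \<comment> \<open>Gluing allows the roots \<open>R2 \<union> \<Union>Q\<close>; the definition
        of \<open>C\<close> excludes parents in \<open>\<Union>Q\<close>, so the codomain shrinks to
        that for \<open>R2\<close>.\<close>
      moreover have "restrict p (P - Q) \<in> (P - Q) \<rightarrow>\<^sub>E R2 \<union> \<Union>(P - Q)" using p by (auto simp: C_def)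
      ultimately have "restrict p (P - Q) \<in> acyclic_maps (P - Q) R2"
        by (simp add: acyclic_maps_def)
      then show "p \<in> ?R"
        using \<open>restrict p Q \<in> _ \<and> _\<close> p acyclic_mapsD(1)[of p P] unfolding C_def by blast
    next
      fix p assume p: "p \<in> ?R"
      have a: "p B \<in> R1 \<union> \<Union>Q" if "B \<in> Q" for B
        using acyclic_mapsD(2)[of "restrict p Q" Q R1 B] p that by auto
      have b: "p B \<in> R2 \<union> \<Union>(P - Q)" if "B \<in> P - Q" for B
        using acyclic_mapsD(2)[of "restrict p (P - Q)" "P - Q" R2 B] p that by auto
      have "restrict p (P - Q) \<in> acyclic_maps (P - Q) (R2 \<union> \<Union>Q)"
        using p by (auto simp: acyclic_maps_def PiE_iff)
      moreover have "p B \<in> R2 \<union> \<Union>P" if "B \<in> P - Q" for B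
        using b[OF that] by blast
      ultimately have "p \<in> acyclic_maps P (R1 \<union> R2)"
        by (intro acyclic_maps_glue_iff[THEN iffD2, of P Q p R1 R2]) (use p P Q R a in auto)
      then show "p \<in> C Q" using a b by (auto simp: C_def)
    qed
    then show ?thesis
      using Q by (simp add: card_extensional_split subset_iff acyclic_mapsD(1))
    qed
  qed
  finally show ?thesis .
qed

section \<open>Binomial sums over families of blocks, and the resulting count\<close>

lemma sum_Pow_powers:
  fixes m n :: "'a::comm_semiring_1"
  assumes "finite P"
  shows "(\<Sum>Q\<in>Pow P. m ^ card Q * n ^ card (P - Q)) = (m + n) ^ card P"
  using prod_add[OF assms, of "\<lambda>_. m" "\<lambda>_. n"] by simp

text \<open>Exchange the two sums: a marked \<open>B\<close> in \<open>Q\<close> contributes one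
  factor \<open>m\<close>, and the rest of \<open>Q\<close> ranges freely over the subsets of
  \<open>P - {B}\<close>, which is the plain binomial sum.\<close>

lemma sum_Pow_powers_weighted:
  fixes m n :: "'a::comm_semiring_1"
  assumes "finite P"
  shows "(\<Sum>Q\<in>Pow P. m ^ card Q * n ^ card (P - Q) * (\<Sum>B\<in>Q. s B)) =
    m * (m + n) ^ (card P - 1) * (\<Sum>B\<in>P. s B)"
proof -
  have "(\<Sum>Q\<in>Pow P. m ^ card Q * n ^ card (P - Q) * (\<Sum>B\<in>Q. s B)) =
      (\<Sum>Q\<in>Pow P. \<Sum>B | B \<in> P \<and> B \<in> Q. m ^ card Q * n ^ card (P - Q) * s B)"
  proof (rule sum.cong[OF refl])
    fix Q assume "Q \<in> Pow P"
    then have "{B. B \<in> P \<and> B \<in> Q} = Q" by blast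
    then show "m ^ card Q * n ^ card (P - Q) * (\<Sum>B\<in>Q. s B) =
        (\<Sum>B | B \<in> P \<and> B \<in> Q. m ^ card Q * n ^ card (P - Q) * s B)"
      by (simp add: sum_distrib_left)
  qed
  also have "\<dots> = (\<Sum>B\<in>P. \<Sum>Q | Q \<in> Pow P \<and> B \<in> Q. m ^ card Q * n ^ card (P - Q) * s B)"
    by (rule sum.swap_restrict) (use assms in auto)
  also have "\<dots> = (\<Sum>B\<in>P. m * (m + n) ^ (card P - 1) * s B)"
  proof (rule sum.cong[OF refl])
    fix B assume B: "B \<in> P"
    have eq: "{Q. Q \<in> Pow P \<and> B \<in> Q} = insert B ` Pow (P - {B})"
    proof (intro set_eqI iffI)
      fix Q assume "Q \<in> {Q. Q \<in> Pow P \<and> B \<in> Q}"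
      then have "Q = insert B (Q - {B})" "Q - {B} \<in> Pow (P - {B})" by auto
      then show "Q \<in> insert B ` Pow (P - {B})" by blast
    qed (use B in auto)
    have inj: "inj_on (insert B) (Pow (P - {B}))" by (auto simp: inj_on_def)
    have "(\<Sum>Q | Q \<in> Pow P \<and> B \<in> Q. m ^ card Q * n ^ card (P - Q) * s B) =
        (\<Sum>Q\<in>Pow (P - {B}). m ^ card Q * n ^ card (P - {B} - Q) * (m * s B))"
      unfolding eq sum.reindex[OF inj] o_def
    proof (rule sum.cong[OF refl])
      fix Q assume Q: "Q \<in> Pow (P - {B})"
      have "card (insert B Q) = Suc (card Q)"
        using Q assms finite_subset[of Q P] by (intro card_insert_disjoint) auto
      moreover have "P - insert B Q = P - {B} - Q" by auto
      ultimately show "m ^ card (insert B Q) * n ^ card (P - insert B Q) * s B =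
          m ^ card Q * n ^ card (P - {B} - Q) * (m * s B)"
        by (simp add: mult_ac)
    qed
    also have "\<dots> = m * (m + n) ^ (card P - 1) * s B"
      using B assms
      by (subst sum_distrib_right[symmetric], subst sum_Pow_powers) (simp_all add: mult_ac)
    finally show "(\<Sum>Q | Q \<in> Pow P \<and> B \<in> Q. m ^ card Q * n ^ card (P - Q) * s B) =
        m * (m + n) ^ (card P - 1) * s B" .
  qed
  finally show ?thesis by (simp add: sum_distrib_left)
qed

lemma disjoint_subset: "disjoint P \<Longrightarrow> Q \<subseteq> P \<Longrightarrow> disjoint Q"
  by (rule pairwise_subset)

text \<open>Both sides carry an extra factor \<open>n = card R + card (\<Union>P)\<close> in order to cover \<open>P = {}\<close>.\<close>

lemma card_acyclic_maps:
  assumes "finite P" "disjoint P" "{} \<notin> P" "\<And>B. B \<in> P \<Longrightarrow> finite B" "finite R" "R \<inter> \<Union>P = {}"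
  shows "card (acyclic_maps P R) * (card R + card (\<Union>P)) = card R * (card R + card (\<Union>P)) ^ card P"
  using assms
proof (induction P arbitrary: R rule: finite_psubset_induct)
  case (psubset P)
  note P = psubset.prems psubset.hyps
  show ?case
  proof (cases "P = {}")
    case False
    define m N where "m = card R" and "N = card (\<Union>P)"
    have finP: "finite (\<Union>P)" using P by auto
    have "\<Union>P \<noteq> {}" using False P(2) by auto
    then have N: "N > 0" using finP by (simp add: N_def card_gt_0_iff)
    have fin: "finite (acyclic_maps P R)" using P by (intro finite_acyclic_maps) auto
    have IH: "card (acyclic_maps (P - Q) (\<Union>Q)) * N = N ^ card (P - Q) * (\<Sum>B\<in>Q. card B)"
      if Q: "Q \<subseteq> P" "Q \<noteq> {}" for Q
    proof -
      have dis: "\<Union>Q \<inter> \<Union>(P - Q) = {}" using disjointD[OF P(1)] Q by blast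
      have disj: "disjoint (P - Q)" "disjoint Q"
        using Q by (auto intro!: disjoint_subset[OF P(1)])
      have PQ: "\<Union>Q \<union> \<Union>(P - Q) = \<Union>P" using Q by auto
      have finQ: "finite (\<Union>Q)" "finite (\<Union>(P - Q))" using finP PQ by (metis finite_Un)+
      have card: "card (\<Union>Q) + card (\<Union>(P - Q)) = N"
        using card_Un_disjoint[OF finQ dis] PQ by (simp add: N_def)
      have "P - Q \<subset> P" using Q by auto
      then have "card (acyclic_maps (P - Q) (\<Union>Q)) * (card (\<Union>Q) + card (\<Union>(P - Q))) =
          card (\<Union>Q) * (card (\<Union>Q) + card (\<Union>(P - Q))) ^ card (P - Q)"
      proof (rule psubset.IH)
        show "{} \<notin> P - Q" using P(2) by simp
        show "finite B" if "B \<in> P - Q" for B using P(3) that by simp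
      qed (fact disj finQ dis)+
      moreover have "card (\<Union>Q) = (\<Sum>B\<in>Q. card B)"
        using P Q disj by (intro card_Union_disjoint) auto
      ultimately show ?thesis using card by (simp add: mult.commute)
    qed
    have "card (acyclic_maps P R) =
        (\<Sum>Q\<in>Pow P. card {p \<in> acyclic_maps P R. {B \<in> P. p B \<in> R} = Q})"
      unfolding card_eq_sum
    proof (rule sum.group[symmetric])
      show "(\<lambda>p. {B \<in> P. p B \<in> R}) ` acyclic_maps P R \<subseteq> Pow P"
        by (intro image_subsetI PowI Collect_restrict)
    qed (simp_all add: fin P)
    then have "card (acyclic_maps P R) * N =
        (\<Sum>Q\<in>Pow P. card {p \<in> acyclic_maps P R. {B \<in> P. p B \<in> R} = Q} * N)"
      by (simp add: sum_distrib_right)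
    also have "\<dots> = (\<Sum>Q\<in>Pow P. m ^ card Q * N ^ card (P - Q) * (\<Sum>B\<in>Q. card B))"
    proof (rule sum.cong[OF refl])
      fix Q assume Q: "Q \<in> Pow P"
      show "card {p \<in> acyclic_maps P R. {B \<in> P. p B \<in> R} = Q} * N =
          m ^ card Q * N ^ card (P - Q) * (\<Sum>B\<in>Q. card B)"
      proof (cases "Q = {}")
        \<comment> \<open>An acyclic map on a nonempty family attaches some block directly to
          \<open>R\<close>, so this fibre is empty; the right-hand side vanishes as well, its sum of
          block sizes being empty.\<close>
        case True
        have "p \<notin> acyclic_maps P R" if "{B \<in> P. p B \<in> R} = {}" for p
        proof
          assume p: "p \<in> acyclic_maps P R"
          then obtain B where "B \<in> P" "p B \<notin> \<Union>P" using acyclic_mapsD(3)[OF p, of P] False by auto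
          then show False using acyclic_mapsD(2)[OF p, of B] that by auto
        qed
        then have "{p \<in> acyclic_maps P R. {B \<in> P. p B \<in> R} = Q} = {}" using True by blast
        then show ?thesis using True by (simp only: card.empty sum.empty mult_0 mult_0_right)
      next
        case False
        have "card {p \<in> acyclic_maps P R. {B \<in> P. p B \<in> R} = Q} * N =
            m ^ card Q * (card (acyclic_maps (P - Q) (\<Union>Q)) * N)"
          unfolding m_def mult.assoc[symmetric]
          by (subst card_acyclic_maps_layer) (use P Q in auto)
        also have "\<dots> = m ^ card Q * N ^ card (P - Q) * (\<Sum>B\<in>Q. card B)"
          using IH[of Q] Q False by simp
        finally show ?thesis .
      qed
    qed
    also have "\<dots> = m * (m + N) ^ (card P - 1) * (\<Sum>B\<in>P. card B)"
      using P by (intro sum_Pow_powers_weighted) auto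
    also have "(\<Sum>B\<in>P. card B) = N"
      unfolding N_def using P by (intro card_Union_disjoint[symmetric]) auto
    finally have "card (acyclic_maps P R) = m * (m + N) ^ (card P - 1)"
      using N by simp
    moreover have "card P = Suc (card P - 1)" using False P by (simp add: card_gt_0_iff)
    ultimately show ?thesis
      unfolding m_def[symmetric] N_def[symmetric]
      by (metis mult.assoc mult.commute power_Suc)
  qed simp
qed

section \<open>Walks in hypertrees\<close>

lemma hwalk_append: "hwalk E u (p @ q) w \<longleftrightarrow> (\<exists>v. hwalk E u p v \<and> hwalk E v q w)"
proof (induction p arbitrary: u)
  case (Cons s p)
  then show ?case by (cases s) auto
qed simp

lemma hwalk_mono: "hwalk E u p w \<Longrightarrow> E \<subseteq> F \<Longrightarrow> hwalk F u p w"
proof (induction p arbitrary: u)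
  case (Cons s p)
  then show ?case by (cases s) auto
qed simp

lemma hwalk_restrict:
  "hwalk F u p w \<Longrightarrow> fst ` set p \<subseteq> E \<Longrightarrow> hwalk E u p w"
proof (induction p arbitrary: u)
  case (Cons s p)
  then show ?case by (cases s) auto
qed simp

lemma hwalk_edges: "hwalk E u p w \<Longrightarrow> fst ` set p \<subseteq> E"
proof (induction p arbitrary: u)
  case (Cons s p)
  then show ?case by (cases s) auto
qed simp

lemma hwalk_vertex: "hwalk E u p w \<Longrightarrow> \<Union>E \<subseteq> V \<Longrightarrow> u \<in> V \<Longrightarrow> w \<in> V"
proof (induction p arbitrary: u)
  case (Cons s p)
  then show ?case by (cases s) auto
qed simp

lemma hypertree_finite: "hypertree V E \<Longrightarrow> finite V"
  by (simp add: hypertree_def hypergraph_def)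

lemma hypertree_edge_subset: "hypertree V E \<Longrightarrow> e \<in> E \<Longrightarrow> e \<subseteq> V"
  by (simp add: hypertree_def hypergraph_def)

lemma hypertree_unique_walk:
  "hypertree V E \<Longrightarrow> u \<in> V \<Longrightarrow> w \<in> V \<Longrightarrow> \<exists>!p. hwalk E u p w \<and> distinct (map fst p)"
  by (simp add: hypertree_def)

lemma hypertree_single: "hypertree {r} {}"
proof -
  have "\<exists>!p. hwalk {} r p r \<and> distinct (map fst p)"
  proof (rule ex1I[of _ "[]"])
    fix p assume "hwalk {} r p r \<and> distinct (map fst p)"
    then show "p = []" by (cases p) auto
  qed simp
  then show ?thesis by (simp add: hypertree_def hypergraph_def)
qed

text \<open>The new edge meets \<open>V\<close> only in \<open>u\<close>, and no old edge meets
  \<open>B\<close>. A walk with distinct edges can therefore pass between \<open>V\<close> and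
  \<open>B\<close> only once and only through \<open>u\<close>, and its remaining part is a walk of
  the old hypertree, where uniqueness is known. Every hypertree is built up by this step.\<close>

lemma hypertree_attach:
  assumes T: "hypertree V E" and u: "u \<in> V" and B: "finite B" "B \<noteq> {}" "B \<inter> V = {}"
  shows "hypertree (V \<union> B) (insert (insert u B) E)"
proof -
  define e where "e = insert u B"
  let ?F = "insert e E"
  have EV: "f \<subseteq> V" if "f \<in> E" for f using hypertree_edge_subset[OF T that] .
  have UE: "\<Union>E \<subseteq> V" using EV by blast
  have eV: "e \<notin> E" using EV[of e] B by (auto simp: e_def)
  have uB: "u \<notin> B" using u B by auto
  have avoid: "hwalk E a p b" if "hwalk ?F a p b" "e \<notin> fst ` set p" for a p b
    using hwalk_edges[OF that(1)] that(2) by (intro hwalk_restrict[OF that(1)]) auto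
  have from_B: "p = []" if "hwalk ?F a p b" "e \<notin> fst ` set p" "a \<in> B" for a p b
  proof (cases p)
    case (Cons s p')
    with that(1) obtain f v where s: "s = (f, v)" "f \<in> ?F" "a \<in> f" by (cases s) auto
    then have "f \<noteq> e" using that(2) Cons by auto
    then show ?thesis using s EV[of f] that(3) B by auto
  qed
  have from_V: "b \<in> V" if "hwalk ?F a p b" "e \<notin> fst ` set p" "a \<in> V" for a p b
    using hwalk_vertex[OF avoid[OF that(1,2)] UE that(3)] .
  \<comment> \<open>The walk meets \<open>e\<close> first at \<open>u\<close>, the only vertex of
    \<open>e\<close> in \<open>V\<close>, and steps into \<open>B\<close>. There it must stop,
    because \<open>e\<close> is used up and is the only edge at a vertex of
    \<open>B\<close>.\<close>
  have from_V': "\<exists>p1 v. p = p1 @ [(e, v)] \<and> b = v \<and> v \<in> B \<and> hwalk E a p1 u"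
    if p: "hwalk ?F a p b" "distinct (map fst p)" "e \<in> fst ` set p" "a \<in> V" for a p b
  proof -
    obtain v where "(e, v) \<in> set p" using p(3) by auto
    then obtain p1 p2 where eq: "p = p1 @ (e, v) # p2" by (meson split_list)
    with p(2) have ne: "e \<notin> fst ` set p1" "e \<notin> fst ` set p2" by auto
    from p(1) eq obtain x where x: "hwalk ?F a p1 x" "x \<in> e" "v \<in> e" "x \<noteq> v" "hwalk ?F v p2 b"
      by (auto simp: hwalk_append)
    have "x \<in> V" using from_V[OF x(1) ne(1) p(4)] .
    then have "x = u" using x(2) B by (auto simp: e_def)
    with x have "v \<in> B" by (auto simp: e_def)
    moreover have "p2 = []" using from_B[OF x(5) ne(2)] \<open>v \<in> B\<close> .
    ultimately show ?thesis
      using eq x avoid[OF x(1) ne(1)] \<open>x = u\<close> by auto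
  qed
  have from_B': "(p = [] \<and> b = a) \<or> (p = [(e, b)] \<and> b \<in> B \<and> b \<noteq> a) \<or>
      (\<exists>p'. p = (e, u) # p' \<and> hwalk E u p' b \<and> b \<in> V)"
    if p: "hwalk ?F a p b" "distinct (map fst p)" "a \<in> B" for a p b
  proof (cases p)
    case (Cons s p')
    with p(1) obtain f v where s: "s = (f, v)" "f \<in> ?F" "a \<in> f" "v \<in> f" "a \<noteq> v" "hwalk ?F v p' b"
      by (cases s) auto
    have "f = e" using s EV[of f] p(3) B by auto
    have ne: "e \<notin> fst ` set p'" using Cons s p(2) \<open>f = e\<close> by auto
    show ?thesis
    proof (cases "v = u")
      case True
      have "hwalk E u p' b" using avoid[OF s(6) ne] True by simp
      moreover have "b \<in> V" using from_V[OF s(6) ne] True u by simp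
      ultimately show ?thesis using Cons s True \<open>f = e\<close> by simp
    next
      case False
      then have "v \<in> B" using s \<open>f = e\<close> by (auto simp: e_def)
      then have "p' = []" using from_B[OF s(6) ne] by simp
      then show ?thesis using Cons s \<open>f = e\<close> \<open>v \<in> B\<close> by auto
    qed
  qed (use p in simp)
  have E_walk: "hwalk ?F a p b" "e \<notin> fst ` set p" if "hwalk E a p b" for a p b
    using hwalk_mono[OF that, of ?F] hwalk_edges[OF that] eV by auto
  have "\<exists>!p. hwalk ?F a p b \<and> distinct (map fst p)" if ab: "a \<in> V \<union> B" "b \<in> V \<union> B" for a b
  proof (cases "a \<in> V")
    case aV: True
    show ?thesis
    proof (cases "b \<in> V")
      case bV: True
      obtain p where p: "hwalk E a p b" "distinct (map fst p)"
        "\<And>q. hwalk E a q b \<Longrightarrow> distinct (map fst q) \<Longrightarrow> q = p"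
        using hypertree_unique_walk[OF T aV bV] by blast
      show ?thesis
      proof (rule ex1I[of _ p])
        show "hwalk ?F a p b \<and> distinct (map fst p)" using E_walk[OF p(1)] p(2) by simp
        fix q assume q: "hwalk ?F a q b \<and> distinct (map fst q)"
        then have "e \<notin> fst ` set q" using from_V'[of a q b] aV bV B by auto
        then show "q = p" using avoid q p(3) by blast
      qed
    next
      case False
      then have bB: "b \<in> B" using ab by simp
      obtain p where p: "hwalk E a p u" "distinct (map fst p)"
        "\<And>q. hwalk E a q u \<Longrightarrow> distinct (map fst q) \<Longrightarrow> q = p"
        using hypertree_unique_walk[OF T aV u] by blast
      show ?thesis
      proof (rule ex1I[of _ "p @ [(e, b)]"])
        show "hwalk ?F a (p @ [(e, b)]) b \<and> distinct (map fst (p @ [(e, b)]))"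
          using E_walk[OF p(1)] p(2) bB uB by (auto simp: hwalk_append e_def)
        fix q assume q: "hwalk ?F a q b \<and> distinct (map fst q)"
        then have "e \<in> fst ` set q" using from_V[of a q b] aV False by blast
        then obtain q1 where "q = q1 @ [(e, b)]" "hwalk E a q1 u"
          using from_V'[of a q b] q aV by blast
        then show "q = p @ [(e, b)]" using q p(3)[of q1] by simp
      qed
    qed
  next
    case False
    then have aB: "a \<in> B" using ab by simp
    show ?thesis
    proof (cases "b \<in> V")
      case bV: True
      then have bB: "b \<notin> B" using B by auto
      obtain p where p: "hwalk E u p b" "distinct (map fst p)"
        "\<And>q. hwalk E u q b \<Longrightarrow> distinct (map fst q) \<Longrightarrow> q = p"
        using hypertree_unique_walk[OF T u bV] by blast
      show ?thesis
      proof (rule ex1I[of _ "(e, u) # p"])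
        show "hwalk ?F a ((e, u) # p) b \<and> distinct (map fst ((e, u) # p))"
          using E_walk[OF p(1)] p(2) aB uB by (auto simp: e_def)
        fix q assume q: "hwalk ?F a q b \<and> distinct (map fst q)"
        then obtain q' where "q = (e, u) # q'" "hwalk E u q' b"
          using from_B'[of a q b] aB bB by blast
        then show "q = (e, u) # p" using q p(3)[of q'] by simp
      qed
    next
      case False
      then have bB: "b \<in> B" using ab by simp
      show ?thesis
      proof (rule ex1I[of _ "if a = b then [] else [(e, b)]"])
        show "hwalk ?F a (if a = b then [] else [(e, b)]) b \<and>
            distinct (map fst (if a = b then [] else [(e, b)]))"
          using aB bB by (auto simp: e_def)
        fix q assume q: "hwalk ?F a q b \<and> distinct (map fst q)"
        then show "q = (if a = b then [] else [(e, b)])"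
          using from_B'[of a q b] aB False by auto
      qed
    qed
  qed
  moreover have "hypergraph (V \<union> B) ?F"
  proof -
    have "card e = Suc (card B)" using B uB by (simp add: e_def)
    moreover have "card B > 0" using B by (simp add: card_gt_0_iff)
    ultimately have "2 \<le> card e" by simp
    then show ?thesis using T u B by (auto simp: hypertree_def hypergraph_def e_def)
  qed
  ultimately show ?thesis using u by (auto simp: hypertree_def e_def)
qed

section \<open>Hypertrees as partitions with parent maps\<close>

definition tree_edges :: "'v set set \<Rightarrow> ('v set \<Rightarrow> 'v) \<Rightarrow> 'v set set" where
  "tree_edges P p = (\<lambda>B. insert (p B) B) ` P"

lemma parent_notin_block: "p \<in> acyclic_maps P R \<Longrightarrow> B \<in> P \<Longrightarrow> p B \<notin> B"
  using acyclic_mapsD(3)[of p P R "{B}"] by simp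

lemma no_mutual_parents:
  assumes "p \<in> acyclic_maps P R" "B \<in> P" "C \<in> P" "p B \<in> C"
  shows "p C \<notin> B"
  using acyclic_mapsD(3)[OF assms(1), of "{B, C}"] assms by auto

text \<open>If two disjoint nonempty blocks gave the same edge, each would contain the parent of the
  other, a cycle of length two.\<close>

lemma inj_on_tree_edge:
  assumes P: "disjoint P" "{} \<notin> P" and p: "p \<in> acyclic_maps P R"
  shows "inj_on (\<lambda>B. insert (p B) B) P"
proof (rule inj_onI, rule ccontr)
  fix B C assume BC: "B \<in> P" "C \<in> P" "insert (p B) B = insert (p C) C" "B \<noteq> C"
  then have "B \<inter> C = {}" using disjointD[OF P(1)] by blast
  moreover obtain x y where xy: "x \<in> B" "y \<in> C" using P(2) BC(1,2) by (metis ex_in_conv)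
  moreover have "x \<in> insert (p C) C" by (subst BC(3)[symmetric]) (simp add: xy)
  moreover have "y \<in> insert (p B) B" by (subst BC(3)) (simp add: xy)
  ultimately have "p B \<in> C" "p C \<in> B" by auto
  then show False using no_mutual_parents[OF p BC(1,2)] by simp
qed

text \<open>Acyclicity of the blocks not yet used provides one whose parent is already present;
  \<open>hypertree_attach\<close> adds its edge. The statement for \<open>k\<close> is that some
  \<open>k\<close> blocks can be attached in this way.\<close>

lemma hypertree_tree_edges:
  assumes V: "finite V" "r \<in> V" and P: "partition_on (V - {r}) P" and p: "p \<in> acyclic_maps P {r}"
  shows "hypertree V (tree_edges P p)"
proof -
  have UP: "\<Union>P = V - {r}" and dis: "disjoint P" and ne: "{} \<notin> P"
    using P by (auto simp: partition_on_def)
  have finP: "finite P" using finite_elements[OF _ P] V by simp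
  have "k \<le> card P \<Longrightarrow> \<exists>Q\<subseteq>P. card Q = k \<and> hypertree (insert r (\<Union>Q)) (tree_edges Q p)" for k
  proof (induction k)
    case 0
    show ?case by (rule exI[of _ "{}"]) (simp add: tree_edges_def hypertree_single)
  next
    case (Suc k)
    then obtain Q where Q: "Q \<subseteq> P" "card Q = k" "hypertree (insert r (\<Union>Q)) (tree_edges Q p)"
      by auto
    have "P - Q \<noteq> {}" using Suc.prems Q by auto
    then obtain B where B: "B \<in> P - Q" "p B \<notin> \<Union>(P - Q)"
      using acyclic_mapsD(3)[OF p, of "P - Q"] by auto
    have pB: "p B \<in> insert r (\<Union>Q)"
      using acyclic_mapsD(2)[OF p, of B] B by auto
    have "B \<inter> C = {}" if "C \<in> Q" for C using disjointD[OF dis, of B C] B Q(1) that by auto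
    moreover have "r \<notin> B" using B UP by auto
    ultimately have Bdis: "B \<inter> insert r (\<Union>Q) = {}" by auto
    have "B \<subseteq> V" using B UP by auto
    then have Bfin: "finite B" "B \<noteq> {}" using V ne B finite_subset by auto
    have "hypertree (insert r (\<Union>Q) \<union> B) (insert (insert (p B) B) (tree_edges Q p))"
      by (rule hypertree_attach[OF Q(3) pB Bfin Bdis])
    moreover have "insert r (\<Union>Q) \<union> B = insert r (\<Union>(insert B Q))" by auto
    moreover have "card (insert B Q) = Suc k"
      using B Q finP finite_subset[OF Q(1)] by auto
    ultimately show ?case
      using Q(1) B by (intro exI[of _ "insert B Q"]) (simp add: tree_edges_def)
  qed
  from this[of "card P"] obtain Q where Q: "Q \<subseteq> P" "card Q = card P"
    "hypertree (insert r (\<Union>Q)) (tree_edges Q p)" by auto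
  then have "Q = P" using card_subset_eq[OF finP] by simp
  moreover have "insert r (\<Union>P) = V" using UP V(2) by auto
  ultimately show ?thesis using Q(3) by simp
qed

lemma tree_edges_unique:
  assumes P: "disjoint P" "{} \<notin> P" "r \<notin> \<Union>P" "p \<in> acyclic_maps P {r}"
    and P': "disjoint P'" "{} \<notin> P'" "r \<notin> \<Union>P'" "p' \<in> acyclic_maps P' {r}"
    and eq: "tree_edges P p = tree_edges P' p'"
  shows "P = P' \<and> p = p'"
proof -
  have same: "B \<in> P' \<and> p' B = p B" if "B \<in> P" for B
  proof -
    \<comment> \<open>The blocks on which the two descriptions disagree. Acyclicity picks one whose
      parent lies in no such block, that is, a disagreement nearest to the root.\<close>
    define Q where "Q = {B \<in> P. \<not> (B \<in> P' \<and> p' B = p B)}"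
    have "Q = {}"
    proof (rule ccontr)
      assume "Q \<noteq> {}"
      then obtain B where B: "B \<in> Q" "p B \<notin> \<Union>Q"
        using acyclic_mapsD(3)[OF P(4), of Q] by (auto simp: Q_def)
      have BP: "B \<in> P" using B by (simp add: Q_def)
      then have "insert (p B) B \<in> tree_edges P p" by (simp add: tree_edges_def)
      then have "insert (p B) B \<in> tree_edges P' p'" by (simp only: eq)
      then obtain C where C: "C \<in> P'" "insert (p B) B = insert (p' C) C"
        by (auto simp: tree_edges_def)
      \<comment> \<open>If the two descriptions singled out different vertices of this edge, then
        \<open>p B\<close> would lie in \<open>C\<close>. The block of \<open>p\<close> around
        \<open>p B\<close> is not in disagreement, so it is \<open>C\<close> itself, and its parent
        would lie in \<open>B\<close>: again a cycle of length two.\<close>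
      have "p' C = p B"
      proof (rule ccontr)
        assume ne: "p' C \<noteq> p B"
        have "p B \<in> insert (p' C) C" using C(2) by blast
        then have pBC: "p B \<in> C" using ne by simp
        then have "p B \<noteq> r" using C P'(3) by auto
        then obtain D where D: "D \<in> P" "p B \<in> D" using acyclic_mapsD(2)[OF P(4) BP] by auto
        then have "D \<notin> Q" using B by auto
        then have "D \<in> P'" "p' D = p D" using D by (auto simp: Q_def)
        then have "D = C" using disjointD[OF P'(1), of D C] C pBC D by auto
        then have "p D \<in> B" using C ne \<open>p' D = p D\<close> by auto
        then show False using no_mutual_parents[OF P(4) BP D(1,2)] by simp
      qed
      moreover have "p B \<notin> B" using parent_notin_block[OF P(4) BP] .
      moreover have "p' C \<notin> C" using parent_notin_block[OF P'(4) C(1)] .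
      ultimately have "C = B" using C(2) by (metis insert_ident)
      then show False using B C \<open>p' C = p B\<close> by (auto simp: Q_def)
    qed
    then show ?thesis using that by (auto simp: Q_def)
  qed
  have "P' \<subseteq> P"
  proof
    fix C assume C: "C \<in> P'"
    then have "insert (p' C) C \<in> tree_edges P p" unfolding eq by (simp add: tree_edges_def)
    then obtain B where B: "B \<in> P" "insert (p' C) C = insert (p B) B" by (auto simp: tree_edges_def)
    then have "insert (p' C) C = insert (p' B) B" "B \<in> P'" using same[OF B(1)] by auto
    then have "C = B" using inj_onD[OF inj_on_tree_edge[OF P'(1,2,4)]] C by blast
    then show "C \<in> P" using B by simp
  qed
  then have "P = P'" using same by auto
  moreover have "p = p'"
    using extensionalityI[OF acyclic_mapsD(1)[OF P(4)]] acyclic_mapsD(1)[OF P'(4)] same \<open>P = P'\<close>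
    by metis
  ultimately show ?thesis by simp
qed

text \<open>\<open>u\<close> is a vertex of \<open>e\<close> with the shortest walk from
  \<open>r\<close>. That walk cannot use \<open>e\<close>, since its part before \<open>e\<close>
  would be the walk to a vertex of \<open>e\<close> nearer to the root; so a final step through
  \<open>e\<close> keeps the edges distinct.\<close>

lemma hypertree_edge_parent:
  assumes T: "hypertree V E" and r: "r \<in> V"
    and wk: "\<And>v. v \<in> V \<Longrightarrow> hwalk E r (wk v) v \<and> distinct (map fst (wk v))" and e: "e \<in> E"
  shows "\<exists>u\<in>e. \<forall>v\<in>e - {u}. wk v = wk u @ [(e, v)]"
proof -
  have eV: "e \<subseteq> V" using hypertree_edge_subset[OF T e] .
  have "card e \<ge> 2" using T e by (simp add: hypertree_def hypergraph_def)
  then have "\<exists>u. u \<in> e" by (cases "e = {}") auto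
  then obtain u where u: "u \<in> e" "\<And>v. v \<in> e \<Longrightarrow> length (wk u) \<le> length (wk v)"
    using ex_has_least_nat[of "\<lambda>u. u \<in> e" _ "\<lambda>u. length (wk u)"] by blast
  have uniq: "q = wk v" if "v \<in> V" "hwalk E r q v" "distinct (map fst q)" for q v
    using hypertree_unique_walk[OF T r that(1)] wk[OF that(1)] that by blast
  have ne: "e \<notin> fst ` set (wk u)"
  proof
    assume "e \<in> fst ` set (wk u)"
    then obtain v where "(e, v) \<in> set (wk u)" by auto
    then obtain p1 p2 where eq: "wk u = p1 @ (e, v) # p2" by (meson split_list)
    have w: "hwalk E r (wk u) u" "distinct (map fst (wk u))" using wk u eV by auto
    then obtain x where x: "hwalk E r p1 x" "x \<in> e" using eq by (auto simp: hwalk_append)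
    have "distinct (map fst p1)" using w eq by simp
    then have "p1 = wk x" using uniq x eV by blast
    then show False using u(2)[OF x(2)] eq by simp
  qed
  have "wk v = wk u @ [(e, v)]" if v: "v \<in> e - {u}" for v
  proof (rule uniq[symmetric])
    have w: "hwalk E r (wk u) u" "distinct (map fst (wk u))" using wk u eV by auto
    then show "hwalk E r (wk u @ [(e, v)]) v" using v u e by (auto simp: hwalk_append)
    show "distinct (map fst (wk u @ [(e, v)]))" using w ne by simp
  qed (use v eV in auto)
  then show ?thesis using u(1) by blast
qed

lemma hypertree_as_tree_edges:
  assumes T: "hypertree V E" and r: "r \<in> V"
  shows "\<exists>P p. partition_on (V - {r}) P \<and> p \<in> acyclic_maps P {r} \<and> tree_edges P p = E"
proof -
  have "\<forall>v\<in>V. \<exists>p. hwalk E r p v \<and> distinct (map fst p)"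
    using hypertree_unique_walk[OF T r] by blast
  then obtain wk where wk: "\<And>v. v \<in> V \<Longrightarrow> hwalk E r (wk v) v \<and> distinct (map fst (wk v))"
    by metis
  then obtain u where u: "\<And>e. e \<in> E \<Longrightarrow> u e \<in> e"
    "\<And>e v. e \<in> E \<Longrightarrow> v \<in> e - {u e} \<Longrightarrow> wk v = wk (u e) @ [(e, v)]"
    using hypertree_edge_parent[OF T r wk] by metis
  have eV: "e \<subseteq> V" if "e \<in> E" for e using hypertree_edge_subset[OF T that] .
  \<comment> \<open>The last edge of the walk to \<open>v\<close> names the block of
    \<open>v\<close>. This gives both injectivity of \<open>f\<close> and disjointness of the
    blocks.\<close>
  have last: "fst (last (wk v)) = e" if "e \<in> E" "v \<in> e - {u e}" for e v
    using u(2)[OF that] by simp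
  define f where "f e = e - {u e}" for e
  have f_ne: "f e \<noteq> {}" if "e \<in> E" for e
  proof
    assume "f e = {}"
    then have "e \<subseteq> {u e}" by (auto simp: f_def)
    then have "card e \<le> 1" using card_mono[of "{u e}" e] by simp
    moreover have "card e \<ge> 2" using T that by (simp add: hypertree_def hypergraph_def)
    ultimately show False by simp
  qed
  have inj: "inj_on f E"
  proof (rule inj_onI)
    fix e e' assume *: "e \<in> E" "e' \<in> E" "f e = f e'"
    obtain v where "v \<in> f e" using f_ne[OF *(1)] by auto
    then have "v \<in> f e'" using *(3) by simp
    then have "v \<in> e - {u e}" "v \<in> e' - {u e'}" using \<open>v \<in> f e\<close> by (simp_all add: f_def)
    then show "e = e'" using last[OF *(1), of v] last[OF *(2), of v] by simp
  qed
  define P where "P = f ` E"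
  define p where "p = restrict (\<lambda>B. u (inv_into E f B)) P"
  have p: "p (f e) = u e" if "e \<in> E" for e
    using that by (simp add: p_def P_def inv_into_f_f[OF inj])
  have part: "partition_on (V - {r}) P"
  proof (rule partition_onI)
    show "\<Union>P = V - {r}"
    proof (intro equalityI subsetI)
      fix v assume "v \<in> \<Union>P"
      then obtain e where e: "e \<in> E" "v \<in> e - {u e}" by (auto simp: P_def f_def)
      have "hwalk E r [] r \<and> distinct (map fst [])" by simp
      then have "wk r = []" using hypertree_unique_walk[OF T r r] wk[OF r] by blast
      then have "v \<noteq> r" using u(2)[OF e] by auto
      then show "v \<in> V - {r}" using e eV[OF e(1)] by auto
    next
      fix v assume v: "v \<in> V - {r}"
      then have w: "hwalk E r (wk v) v" "distinct (map fst (wk v))" using wk by auto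
      then have "wk v \<noteq> []" using v by auto
      then obtain q e w where eq: "wk v = q @ [(e, w)]" by (metis rev_exhaust surj_pair)
      then have e: "e \<in> E" "v \<in> e" using w by (auto simp: hwalk_append)
      \<comment> \<open>Otherwise the walk to any further vertex of \<open>e\<close> would extend
        the walk to \<open>v\<close>, which already ends with \<open>e\<close>, and so would use
        \<open>e\<close> twice.\<close>
      have "v \<noteq> u e"
      proof
        assume vu: "v = u e"
        obtain x where x: "x \<in> e - {u e}" using f_ne[OF e(1)] by (auto simp: f_def)
        have "x \<in> V" using x eV[OF e(1)] by auto
        then have "distinct (map fst (wk x))" using wk by blast
        then show False using u(2)[OF e(1) x] eq vu by simp
      qed
      then show "v \<in> \<Union>P" using e by (auto simp: P_def f_def)
    qed
    show "{} \<notin> P" using f_ne by (auto simp: P_def)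
    fix A B assume AB: "A \<in> P" "B \<in> P" "A \<noteq> B"
    then obtain e e' where e: "e \<in> E" "e' \<in> E" "A = f e" "B = f e'" by (auto simp: P_def)
    show "disjnt A B"
      unfolding disjnt_iff
    proof (intro allI notI)
      fix v assume "v \<in> A \<and> v \<in> B"
      then have "v \<in> e - {u e}" "v \<in> e' - {u e'}" using e by (simp_all add: f_def)
      then have "e = e'" using last[OF e(1), of v] last[OF e(2), of v] by simp
      then show False using AB(3) e by simp
    qed
  qed
  have "p \<in> acyclic_maps P {r}"
    unfolding acyclic_maps_def
  proof (intro CollectI conjI allI impI)
    have "p B \<in> {r} \<union> \<Union>P" if B: "B \<in> P" for B
    proof -
      obtain e where e: "e \<in> E" "B = f e" using B by (auto simp: P_def)
      then have "p B \<in> V" using p u(1) eV by auto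
      then show ?thesis using partition_onD1[OF part] by auto
    qed
    then show "p \<in> P \<rightarrow>\<^sub>E {r} \<union> \<Union>P" by (simp add: p_def PiE_iff)
    \<comment> \<open>A block whose parent has the shortest walk works: a parent inside a block
      \<open>C\<close> of \<open>Q\<close> is one step farther from the root than the parent of
      \<open>C\<close>.\<close>
    fix Q assume Q: "Q \<subseteq> P" "Q \<noteq> {}"
    then have "\<exists>B. B \<in> Q" by auto
    then obtain B where B: "B \<in> Q" "\<And>C. C \<in> Q \<Longrightarrow> length (wk (p B)) \<le> length (wk (p C))"
      using ex_has_least_nat[of "\<lambda>B. B \<in> Q" _ "\<lambda>B. length (wk (p B))"] by blast
    have "p B \<notin> C" if C: "C \<in> Q" for C
    proof
      assume pB: "p B \<in> C"
      obtain e where e: "e \<in> E" "C = f e" using C Q by (auto simp: P_def)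
      then have "wk (p B) = wk (p C) @ [(e, p B)]" using u(2)[OF e(1), of "p B"] pB p by (auto simp: f_def)
      then show False using B(2)[OF C] by simp
    qed
    then show "\<exists>B\<in>Q. p B \<notin> \<Union>Q" using B(1) by blast
  qed
  moreover have "tree_edges P p = E"
  proof -
    have "insert (p (f e)) (f e) = e" if "e \<in> E" for e
      using p[OF that] u(1)[OF that] by (auto simp: f_def)
    then show ?thesis by (auto simp: tree_edges_def P_def image_image)
  qed
  ultimately show ?thesis using part by blast
qed

lemma bij_betw_tree_edges:
  assumes "finite V" "r \<in> V"
  shows "bij_betw (\<lambda>(P, p). tree_edges P p)
    (SIGMA P:{P. partition_on (V - {r}) P}. acyclic_maps P {r}) (hypertrees V)"
proof (rule bij_betwI')
  fix x y assume xy: "x \<in> (SIGMA P:{P. partition_on (V - {r}) P}. acyclic_maps P {r})"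
    "y \<in> (SIGMA P:{P. partition_on (V - {r}) P}. acyclic_maps P {r})"
  obtain P p P' p' where eq: "x = (P, p)" "y = (P', p')" by (cases x, cases y)
  with xy have *: "partition_on (V - {r}) P" "p \<in> acyclic_maps P {r}"
    "partition_on (V - {r}) P'" "p' \<in> acyclic_maps P' {r}" by auto
  have "P = P' \<and> p = p'" if "tree_edges P p = tree_edges P' p'"
    by (rule tree_edges_unique[OF _ _ _ *(2) _ _ _ *(4) that])
      (use *(1,3) in \<open>auto simp: partition_on_def\<close>)
  then show "((case x of (P, p) \<Rightarrow> tree_edges P p) = (case y of (P, p) \<Rightarrow> tree_edges P p)) = (x = y)"
    using eq by auto
next
  fix x assume "x \<in> (SIGMA P:{P. partition_on (V - {r}) P}. acyclic_maps P {r})"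
  then show "(case x of (P, p) \<Rightarrow> tree_edges P p) \<in> hypertrees V"
    using hypertree_tree_edges[OF assms] by (auto simp: hypertrees_def)
next
  fix E assume "E \<in> hypertrees V"
  then have "hypertree V E" by (simp add: hypertrees_def)
  then obtain P p where "partition_on (V - {r}) P" "p \<in> acyclic_maps P {r}" "tree_edges P p = E"
    using hypertree_as_tree_edges[OF _ assms(2)] by blast
  then show "\<exists>x\<in>SIGMA P:{P. partition_on (V - {r}) P}. acyclic_maps P {r}.
      E = (case x of (P, p) \<Rightarrow> tree_edges P p)"
    by (intro bexI[of _ "(P, p)"]) auto
qed

section \<open>Dimensions of spaces of decorated structures\<close>

lemma sum_fun_apply: "sum f A x = (\<Sum>a\<in>A. f a x)"
  by (induction A rule: infinite_finite_induct) auto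

interpretation tensor: vector_space "\<lambda>(c::'k::field) u \<phi>. c * u \<phi>"
  by unfold_locales (simp_all add: fun_eq_iff distrib_left distrib_right mult.assoc)

interpretation dec: vector_space "\<lambda>(c::'k::field) f h \<phi>. c * f h \<phi>"
  by unfold_locales (rule ext, rule ext, simp add: distrib_left distrib_right mult.assoc)+

text \<open>The dual functional of the basis tensor given by \<open>b\<close>: the coefficient of
  the pure tensor of \<open>d\<close> along it.\<close>

definition coord_form ::
    "('k::field \<Rightarrow> 'b::ab_group_add \<Rightarrow> 'b) \<Rightarrow> (nat set \<Rightarrow> 'b set) \<Rightarrow> nat set set
      \<Rightarrow> (nat set \<Rightarrow> 'b) \<Rightarrow> (nat set \<Rightarrow> 'b) \<Rightarrow> 'k" where
  "coord_form scale B E b d = (\<Prod>e\<in>E. module.representation scale (B e) (d e) (b e))"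

context vector_space
begin

lemma pure_tensor_add:
  assumes "d \<in> PiE E S" "e \<in> E" "x \<in> S e" "y \<in> S e"
  shows "pure_tensor scale S E (d(e := x + y)) =
    pure_tensor scale S E (d(e := x)) + pure_tensor scale S E (d(e := y))"
  using assms by (auto simp: pure_tensor_def multilinear_form_def fun_eq_iff)

lemma pure_tensor_scale:
  assumes "d \<in> PiE E S" "e \<in> E" "x \<in> S e"
  shows "pure_tensor scale S E (d(e := scale c x)) = (\<lambda>\<phi>. c * pure_tensor scale S E (d(e := x)) \<phi>)"
  using assms by (auto simp: pure_tensor_def multilinear_form_def fun_eq_iff)

lemma multilinear_coord_form:
  assumes "finite E" and B: "\<And>e. e \<in> E \<Longrightarrow> independent (B e)" "\<And>e. e \<in> E \<Longrightarrow> span (B e) = S e"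
  shows "multilinear_form scale S E (coord_form scale B E b)"
proof -
  have upd: "coord_form scale B E b (d(e := x)) =
      representation (B e) x (b e) * (\<Prod>e'\<in>E - {e}. representation (B e') (d e') (b e'))"
    if "e \<in> E" for d e x
    using assms(1) that by (simp add: coord_form_def prod.remove[of E e])
  show ?thesis
    unfolding multilinear_form_def
  proof (intro ballI allI)
    fix d e x y c assume "d \<in> PiE E S" "e \<in> E" "x \<in> S e" "y \<in> S e"
    then show "coord_form scale B E b (d(e := x + y)) = coord_form scale B E b (d(e := x)) + coord_form scale B E b (d(e := y)) \<and>
        coord_form scale B E b (d(e := scale c x)) = c * coord_form scale B E b (d(e := x))"
      using B[of e] by (simp add: upd representation_add representation_scale algebra_simps)
  qed
qed

lemma pure_tensor_coord_form:
  assumes "finite E" and B: "\<And>e. e \<in> E \<Longrightarrow> independent (B e)" "\<And>e. e \<in> E \<Longrightarrow> span (B e) = S e"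
    and b: "b \<in> PiE E B" "b' \<in> PiE E B"
  shows "pure_tensor scale S E b (coord_form scale B E b') = (if b = b' then 1 else 0)"
proof -
  have "coord_form scale B E b' b = (\<Prod>e\<in>E. if b e = b' e then 1 else 0)"
    unfolding coord_form_def
  proof (rule prod.cong[OF refl])
    fix e assume "e \<in> E"
    then show "representation (B e) (b e) (b' e) = (if b e = b' e then 1 else 0)"
      using B[of e] b by (simp add: representation_basis PiE_mem)
  qed
  also have "\<dots> = (if b = b' then 1 else 0)"
  proof (cases "b = b'")
    case False
    then obtain e where "e \<in> E" "b e \<noteq> b' e" using PiE_ext[OF b] by auto
    then show ?thesis using False assms(1) by auto
  qed simp
  finally show ?thesis
    using multilinear_coord_form[OF assms(1-3)] by (simp add: pure_tensor_def)
qed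

text \<open>Multilinear expansion, one factor at a time. \<open>F\<close> contains the factors that
  are possibly not yet basis vectors, and the induction on \<open>F\<close> expands one of
  them.\<close>

lemma pure_tensor_in_span:
  assumes "finite F" "F \<subseteq> E" and B: "\<And>e. e \<in> E \<Longrightarrow> span (B e) = S e"
    and d: "d \<in> PiE E S" "\<And>e. e \<in> E - F \<Longrightarrow> d e \<in> B e"
  shows "pure_tensor scale S E d \<in> tensor.span (pure_tensor scale S E ` PiE E B)"
  using assms(1,2) d
proof (induction F arbitrary: d rule: finite_induct)
  case empty
  then have "d \<in> PiE E B" by (auto simp: PiE_iff)
  then show ?case by (intro tensor.span_base) auto
next
  case (insert e F)
  let ?T = "tensor.span (pure_tensor scale S E ` PiE E B)"
  have e: "e \<in> E" using insert.prems by simp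
  have upd: "d(e := x) \<in> PiE E S" if "x \<in> S e" for x
    using insert.prems(2) that e by (auto simp: PiE_iff extensional_def)
  \<comment> \<open>Membership in \<open>S e\<close> is carried along because pure tensors are known
    to be additive and homogeneous only for vectors of \<open>S e\<close>.\<close>
  have "x \<in> S e \<and> pure_tensor scale S E (d(e := x)) \<in> ?T" if "x \<in> span (B e)" for x
    using that
  proof (induction rule: span_induct)
    case base
    have sub: "subspace (S e)" using B[OF e] subspace_span[of "B e"] by simp
    have "0 \<in> S e" using sub by (rule subspace_0)
    have "pure_tensor scale S E (d(e := scale 0 0)) = 0"
      using pure_tensor_scale[of d E S e 0 0] insert.prems(2) e \<open>0 \<in> S e\<close> by (simp add: fun_eq_iff)
    then have 0: "pure_tensor scale S E (d(e := 0)) \<in> ?T" by (simp add: tensor.span_zero)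
    show ?case
    proof (rule subspaceI; unfold mem_Collect_eq)
      show "0 \<in> S e \<and> pure_tensor scale S E (d(e := 0)) \<in> ?T"
        using 0 \<open>0 \<in> S e\<close> by blast
    next
      fix x y assume "x \<in> S e \<and> pure_tensor scale S E (d(e := x)) \<in> ?T"
        "y \<in> S e \<and> pure_tensor scale S E (d(e := y)) \<in> ?T"
      then show "x + y \<in> S e \<and> pure_tensor scale S E (d(e := x + y)) \<in> ?T"
        using pure_tensor_add[OF insert.prems(2) e, of x y] subspace_add[OF sub]
        by (metis tensor.span_add)
    next
      fix c x assume "x \<in> S e \<and> pure_tensor scale S E (d(e := x)) \<in> ?T"
      then show "scale c x \<in> S e \<and> pure_tensor scale S E (d(e := scale c x)) \<in> ?T"
        using pure_tensor_scale[OF insert.prems(2) e, of x c] subspace_scale[OF sub]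
        by (metis tensor.span_scale)
    qed
  next
    case (step x)
    have x: "x \<in> S e" using step span_base B[OF e] by blast
    moreover have "pure_tensor scale S E (d(e := x)) \<in> ?T"
      by (rule insert.IH) (use insert.prems upd[OF x] step in auto)
    ultimately show ?case by (rule conjI)
  qed
  moreover have "d e \<in> span (B e)" using B[OF e] insert.prems(2) e by auto
  ultimately have "pure_tensor scale S E (d(e := d e)) \<in> ?T" by blast
  then show ?case by simp
qed

lemma tensor_space_eq_span_basis:
  assumes "finite E" and B: "\<And>e. e \<in> E \<Longrightarrow> span (B e) = S e"
  shows "tensor_space scale S E = tensor.span (pure_tensor scale S E ` PiE E B)"
proof -
  have "PiE E B \<subseteq> PiE E S"
    using B span_superset by (intro PiE_mono) blast
  then show ?thesis
    unfolding tensor_space_def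
    using pure_tensor_in_span[OF assms(1) subset_refl B]
    by (intro equalityI tensor.span_mono image_mono tensor.span_minimal) auto
qed

text \<open>Turns the linear case into the set case: the basis of the direct sum is indexed by
  hypertrees decorated with basis vectors. \<open>vec\<close> places a basis tensor in the summand
  of \<open>h\<close>, \<open>ev\<close> is the dual functional, so applying \<open>ev\<close> to a
  linear relation isolates one coefficient. For spanning, an element is the finite sum of its
  components in the summands.\<close>

lemma decorated_dim_eq_card:
  fixes X :: "'h set"
  assumes X: "finite X" "\<And>h. h \<in> X \<Longrightarrow> finite (ed h)"
    and B: "\<And>h e. h \<in> X \<Longrightarrow> e \<in> ed h \<Longrightarrow> independent (B e)"
      "\<And>h e. h \<in> X \<Longrightarrow> e \<in> ed h \<Longrightarrow> span (B e) = S e"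
      "\<And>h e. h \<in> X \<Longrightarrow> e \<in> ed h \<Longrightarrow> finite (B e)"
  shows "decorated_dim scale S ed X = card (decorated B ed X)"
proof -
  define I where "I = decorated B ed X"
  define vec where "vec = (\<lambda>(h, b) h'. if h' = h then pure_tensor scale S (ed h) b else 0)"
  define ev where "ev = (\<lambda>(h, b) (w :: 'h \<Rightarrow> ((nat set \<Rightarrow> 'b) \<Rightarrow> 'a) \<Rightarrow> 'a). w h (coord_form scale B (ed h) b))"
  have finI: "finite I"
    using assms by (auto simp: I_def decorated_def intro!: finite_SigmaI finite_PiE)
  have ev: "ev j (vec i) = (if i = j then 1 else 0)" if ij: "i \<in> I" "j \<in> I" for i j
  proof -
    obtain h b h' b' where eq: "i = (h, b)" "j = (h', b')" by (cases i, cases j)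
    with ij have *: "h \<in> X" "b \<in> PiE (ed h) B" "h' \<in> X" "b' \<in> PiE (ed h') B"
      by (auto simp: I_def decorated_def)
    show ?thesis
      using pure_tensor_coord_form[of "ed h'" B S b b'] * X B by (auto simp: eq ev_def vec_def)
  qed
  have inj: "inj_on vec I"
    by (rule inj_onI) (metis ev zero_neq_one)
  have coeff: "f v = 0"
    if f: "(\<Sum>x\<in>vec ` I. (\<lambda>h \<phi>. f x * x h \<phi>)) = 0" and v: "v \<in> vec ` I" for f v
  proof -
    obtain j where j: "j \<in> I" "v = vec j" using v by auto
    have "0 = ev j (\<Sum>i\<in>I. (\<lambda>h \<phi>. f (vec i) * vec i h \<phi>))"
      using f by (simp add: sum.reindex[OF inj] o_def ev_def split_def)
    also have "\<dots> = (\<Sum>i\<in>I. f (vec i) * ev j (vec i))"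
      by (simp add: ev_def split_def sum_fun_apply)
    also have "\<dots> = (\<Sum>i\<in>I. if i = j then f (vec i) else 0)"
      by (rule sum.cong[OF refl]) (subst ev[OF _ j(1)], assumption, simp)
    also have "\<dots> = f v" using j finI by simp
    finally show ?thesis by (rule sym)
  qed
  have ts: "tensor_space scale S (ed h) = tensor.span (pure_tensor scale S (ed h) ` PiE (ed h) B)"
    if "h \<in> X" for h
    using X(2)[OF that] B(2)[OF that] by (rule tensor_space_eq_span_basis)
  have "dec.independent (vec ` I)"
    unfolding dec.dependent_finite[OF finite_imageI[OF finI]] using coeff by blast
  moreover have "decorated_space scale S ed X = dec.span (vec ` I)"
  proof (intro equalityI subsetI)
    fix f assume f: "f \<in> decorated_space scale S ed X"
    have "(\<lambda>h'. if h' = h then f h else 0) \<in> dec.span (vec ` I)" if h: "h \<in> X" for h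
    proof -
      have "f h \<in> tensor_space scale S (ed h)"
        using f h by (simp add: decorated_space_def)
      then have "f h \<in> tensor.span (pure_tensor scale S (ed h) ` PiE (ed h) B)"
        by (simp only: ts[OF h])
      then show ?thesis
      proof (induction rule: tensor.span_induct)
        case base
        have "(\<lambda>h'. if h' = h then 0 else 0) \<in> dec.span (vec ` I)"
          using dec.span_zero[of "vec ` I"] by (simp add: zero_fun_def)
        moreover have "(\<lambda>h'. if h' = h then x + y else 0) \<in> dec.span (vec ` I)"
          if "(\<lambda>h'. if h' = h then x else 0) \<in> dec.span (vec ` I)"
            "(\<lambda>h'. if h' = h then y else 0) \<in> dec.span (vec ` I)" for x y
        proof -
          have "(\<lambda>h'. if h' = h then x + y else 0) =
              (\<lambda>h'. if h' = h then x else 0) + (\<lambda>h'. if h' = h then y else 0)"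
            by (auto simp: fun_eq_iff)
          then show ?thesis using dec.span_add[OF that] by simp
        qed
        moreover have "(\<lambda>h'. if h' = h then (\<lambda>\<phi>. c * x \<phi>) else 0) \<in> dec.span (vec ` I)"
          if "(\<lambda>h'. if h' = h then x else 0) \<in> dec.span (vec ` I)" for c x
        proof -
          have "(\<lambda>h'. if h' = h then (\<lambda>\<phi>. c * x \<phi>) else 0) =
              (\<lambda>h' \<phi>. c * (if h' = h then x else 0) \<phi>)"
            by (auto simp: fun_eq_iff)
          then show ?thesis using dec.span_scale[OF that] by simp
        qed
        ultimately show ?case unfolding tensor.subspace_def mem_Collect_eq by (simp add: zero_fun_def)
      next
        case (step u)
        then obtain b where "b \<in> PiE (ed h) B" "u = pure_tensor scale S (ed h) b" by auto
        then have "(h, b) \<in> I" "vec (h, b) = (\<lambda>h'. if h' = h then u else 0)"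
          using h by (auto simp: I_def decorated_def vec_def)
        then show ?case using dec.span_base[of "vec (h, b)" "vec ` I"] by (metis imageI)
      qed
    qed
    then have "(\<Sum>h\<in>X. (\<lambda>h'. if h' = h then f h else 0)) \<in> dec.span (vec ` I)"
      by (rule dec.span_sum)
    moreover have "(\<Sum>h\<in>X. (\<lambda>h'. if h' = h then f h else 0)) = f"
      using f X(1) by (auto simp: fun_eq_iff sum_fun_apply decorated_space_def)
    ultimately show "f \<in> dec.span (vec ` I)" by simp
  next
    fix f assume "f \<in> dec.span (vec ` I)"
    moreover have "vec ` I \<subseteq> decorated_space scale S ed X"
    proof clarify
      fix h b assume "(h, b) \<in> I"
      then have hb: "h \<in> X" "b \<in> PiE (ed h) B" by (auto simp: I_def decorated_def)
      have "pure_tensor scale S (ed h) b \<in> tensor_space scale S (ed h)"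
        unfolding ts[OF hb(1)] using hb(2) by (intro tensor.span_base imageI)
      then show "vec (h, b) \<in> decorated_space scale S ed X"
        using hb(1) by (auto simp: decorated_space_def vec_def tensor_space_def tensor.span_zero)
    qed
    moreover have "dec.subspace (decorated_space scale S ed X)"
      by (rule dec.subspaceI)
        (auto simp: decorated_space_def tensor_space_def fun_eq_iff
          intro: tensor.span_zero tensor.span_add tensor.span_scale)
    ultimately show "f \<in> decorated_space scale S ed X"
      using dec.span_minimal by blast
  qed
  ultimately show ?thesis
    unfolding decorated_dim_def I_def[symmetric]
    by (simp add: dec.dim_eq_card_independent card_image[OF inj])
qed

end

section \<open>Partition sums\<close>

lemma partition_on_finiteD:
  assumes "finite A" "partition_on A P"
  shows "finite P" "disjoint P" "{} \<notin> P" "\<Union>P = A" "\<And>B. B \<in> P \<Longrightarrow> finite B"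
proof -
  show "finite P" by (rule finite_elements[OF assms])
  show "disjoint P" "{} \<notin> P" and U: "\<Union>P = A" using assms(2) by (simp_all add: partition_on_def)
  show "finite B" if "B \<in> P" for B
    using U that by (intro finite_subset[OF _ assms(1)]) auto
qed

text \<open>Cancels the auxiliary factor of \<open>card_acyclic_maps\<close>. For empty
  \<open>P\<close> the truncated exponent is \<open>0\<close>, matching the single empty
  map.\<close>

lemma card_acyclic_maps_single_root:
  assumes "finite A" "partition_on A P" "r \<notin> A"
  shows "card (acyclic_maps P {r}) = Suc (card A) ^ (card P - 1)"
proof -
  note P = partition_on_finiteD[OF assms(1,2)]
  define n where "n = Suc (card A)"
  have "card (acyclic_maps P {r}) * n = n ^ card P"
    using card_acyclic_maps[OF P(1-3,5), of "{r}"] assms(3) P(4) by (simp add: n_def)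
  moreover have "n > 0" by (simp add: n_def)
  ultimately have "card (acyclic_maps P {r}) = n ^ (card P - 1)" by (cases "card P") auto
  then show ?thesis by (simp add: n_def)
qed

text \<open>The block attached to the gap takes over the role of the root set.\<close>

definition hollow_count :: "'v set set \<Rightarrow> nat" where
  "hollow_count P = (\<Sum>B\<in>P. card (acyclic_maps (P - {B}) B))"

text \<open>Moving \<open>B\<close> from the blocks to the roots leaves the total number of vertices
  unchanged. \<open>R\<close> is empty when counting hollow hypertrees and \<open>{r}\<close> in the
  product formula.\<close>

lemma card_acyclic_maps_remove:
  assumes A: "finite A" and P: "partition_on A P" and B: "B \<in> P" and R: "finite R" "R \<inter> A = {}"
  shows "card (acyclic_maps (P - {B}) (R \<union> B)) * (card R + card A) =
    (card R + card B) * (card R + card A) ^ (card P - 1)"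
proof -
  note P' = partition_on_finiteD[OF A P]
  have BA: "B \<subseteq> A" using P'(4) B by auto
  have dis: "B \<inter> \<Union>(P - {B}) = {}" using disjointD[OF P'(2) B] by auto
  have U: "B \<union> \<Union>(P - {B}) = A" using P'(4) B by auto
  have cA: "card A = card B + card (\<Union>(P - {B}))"
    using card_Un_disjoint[OF _ _ dis] A U by (metis finite_Un)
  have "R \<inter> B = {}" using R BA by auto
  then have cR: "card (R \<union> B) = card R + card B" using R P'(5)[OF B] by (simp add: card_Un_disjoint)
  have "card (acyclic_maps (P - {B}) (R \<union> B)) * (card (R \<union> B) + card (\<Union>(P - {B}))) =
      card (R \<union> B) * (card (R \<union> B) + card (\<Union>(P - {B}))) ^ card (P - {B})"
  proof (rule card_acyclic_maps)
    show "disjoint (P - {B})" by (rule disjoint_subset[OF P'(2)]) auto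
    show "(R \<union> B) \<inter> \<Union>(P - {B}) = {}" using dis R U by auto
    show "finite C" if "C \<in> P - {B}" for C using P'(5) that by simp
  qed (use P' R B in simp_all)
  then show ?thesis using B P'(1) by (simp add: cR cA add.assoc)
qed

text \<open>Each block \<open>B\<close> contributes in proportion to its size, and the sizes add up
  to \<open>card A\<close>, which cancels.\<close>

lemma hollow_count_eq:
  assumes A: "finite A" and P: "partition_on A P"
  shows "hollow_count P = (if P = {} then 0 else card A ^ (card P - 1))"
proof (cases "P = {}")
  case False
  note P' = partition_on_finiteD[OF A P]
  then have "A \<noteq> {}" using False by auto
  then have pos: "card A > 0" using A by (simp add: card_gt_0_iff)
  have "hollow_count P * card A = (\<Sum>B\<in>P. card B * card A ^ (card P - 1))"
    using card_acyclic_maps_remove[OF A P, of _ "{}"] by (simp add: hollow_count_def sum_distrib_right)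
  also have "\<dots> = card A * card A ^ (card P - 1)"
    using product_partition[OF P P'(5)]
    by (simp flip: sum_distrib_right)
  finally show ?thesis using pos False by simp
qed (simp add: hollow_count_def)

text \<open>
  The sum counts the acyclic maps with a distinguished block attached to \<open>r\<close>: \<open>Q\<close> consists of this
  block and its descendants.
\<close>

lemma hollow_convolution:
  assumes A: "finite A" and P: "partition_on A P" and r: "r \<notin> A"
  shows "(card A + card P) * card (acyclic_maps P {r}) =
    Suc (card A) * (\<Sum>Q\<in>Pow P. hollow_count Q * card (acyclic_maps (P - Q) {r}))"
proof -
  note P' = partition_on_finiteD[OF A P]
  have "(\<Sum>Q\<in>Pow P. hollow_count Q * card (acyclic_maps (P - Q) {r})) =
      (\<Sum>Q\<in>Pow P. \<Sum>B | B \<in> P \<and> B \<in> Q. card (acyclic_maps (Q - {B}) B) * card (acyclic_maps (P - Q) {r}))"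
  proof (rule sum.cong[OF refl])
    fix Q assume "Q \<in> Pow P"
    then have "{B. B \<in> P \<and> B \<in> Q} = Q" by blast
    then show "hollow_count Q * card (acyclic_maps (P - Q) {r}) =
        (\<Sum>B | B \<in> P \<and> B \<in> Q. card (acyclic_maps (Q - {B}) B) * card (acyclic_maps (P - Q) {r}))"
      by (simp add: hollow_count_def sum_distrib_right)
  qed
  also have "\<dots> = (\<Sum>B\<in>P. \<Sum>Q | Q \<in> Pow P \<and> B \<in> Q.
      card (acyclic_maps (Q - {B}) B) * card (acyclic_maps (P - Q) {r}))"
    by (rule sum.swap_restrict) (use P' in simp_all)
  \<comment> \<open>For fixed \<open>B\<close> the inner sum is a splitting by descent from the two
    root sets \<open>B\<close> and \<open>{r}\<close>, so it counts the acyclic maps over their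
    union.\<close>
  also have "\<dots> = (\<Sum>B\<in>P. card (acyclic_maps (P - {B}) ({r} \<union> B)))"
  proof (rule sum.cong[OF refl])
    fix B assume B: "B \<in> P"
    have "(\<Sum>Q | Q \<in> Pow P \<and> B \<in> Q. card (acyclic_maps (Q - {B}) B) * card (acyclic_maps (P - Q) {r})) =
        (\<Sum>Q\<in>Pow (P - {B}). card (acyclic_maps Q B) * card (acyclic_maps (P - {B} - Q) {r}))"
    proof (rule sum.reindex_bij_witness[of _ "insert B" "\<lambda>Q. Q - {B}"])
      fix Q assume "Q \<in> {Q. Q \<in> Pow P \<and> B \<in> Q}"
      then show "insert B (Q - {B}) = Q" "Q - {B} \<in> Pow (P - {B})" by auto
      then have "P - {B} - (Q - {B}) = P - Q" by auto
      then show "card (acyclic_maps (Q - {B}) B) * card (acyclic_maps (P - {B} - (Q - {B})) {r}) =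
          card (acyclic_maps (Q - {B}) B) * card (acyclic_maps (P - Q) {r})" by simp
    next
      fix Q assume "Q \<in> Pow (P - {B})"
      then show "insert B Q - {B} = Q" "insert B Q \<in> {Q. Q \<in> Pow P \<and> B \<in> Q}" using B by auto
    qed
    also have "\<dots> = card (acyclic_maps (P - {B}) (B \<union> {r}))"
    proof (rule card_acyclic_maps_split[symmetric])
      show "disjoint (P - {B})" by (rule disjoint_subset[OF P'(2)]) auto
      show "B \<inter> \<Union>(P - {B}) = {}" using disjointD[OF P'(2) B] by auto
      show "finite C" if "C \<in> P - {B}" for C using P'(5) that by simp
      show "B \<inter> {r} = {}" "{r} \<inter> \<Union>(P - {B}) = {}" using r B P'(4) by auto
    qed (use P' B in simp_all)
    finally show "(\<Sum>Q | Q \<in> Pow P \<and> B \<in> Q. card (acyclic_maps (Q - {B}) B) * card (acyclic_maps (P - Q) {r})) =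
        card (acyclic_maps (P - {B}) ({r} \<union> B))" by (simp add: Un_commute)
  qed
  finally have conv: "(\<Sum>Q\<in>Pow P. hollow_count Q * card (acyclic_maps (P - Q) {r})) =
      (\<Sum>B\<in>P. card (acyclic_maps (P - {B}) ({r} \<union> B)))" .
  have "(\<Sum>B\<in>P. card (acyclic_maps (P - {B}) ({r} \<union> B))) * Suc (card A) =
      (\<Sum>B\<in>P. Suc (card B) * Suc (card A) ^ (card P - 1))"
    unfolding sum_distrib_right
    by (rule sum.cong[OF refl]) (use card_acyclic_maps_remove[OF A P, of _ "{r}"] r in simp)
  \<comment> \<open>\<open>Suc (card B)\<close> is the size of the edge of \<open>B\<close>, so the
    sum is the number of incidences between vertices and edges, equal for all hypertrees on the
    partition.\<close>
  also have "\<dots> = (card A + card P) * Suc (card A) ^ (card P - 1)"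
    using product_partition[OF P P'(5)]
    by (simp only: sum_distrib_right[symmetric] Suc_eq_plus1 sum.distrib) simp
  finally show ?thesis
    unfolding conv card_acyclic_maps_single_root[OF A P r] by (simp add: mult.commute)
qed

lemma bij_betw_partition_image:
  assumes f: "bij_betw f A B"
  shows "bij_betw ((`) ((`) f)) {P. partition_on A P} {P. partition_on B P}"
proof -
  define g where "g = inv_into A f"
  have g: "bij_betw g B A" "\<And>x. x \<in> A \<Longrightarrow> g (f x) = x" "\<And>y. y \<in> B \<Longrightarrow> f (g y) = y"
    using f bij_betw_inv_into by (auto simp: g_def bij_betw_inv_into_left bij_betw_inv_into_right)
  have img: "partition_on D ((`) h ` P)" if "bij_betw h C D" "partition_on C P" for h C D and P
  proof -
    have "{} \<notin> (`) h ` P" using partition_onD3[OF that(2)] by auto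
    then show ?thesis
      using partition_on_inj_image[OF that(2) bij_betw_imp_inj_on[OF that(1)]]
        bij_betw_imp_surj_on[OF that(1)] by simp
  qed
  have id: "(`) k ` (`) h ` P = P" if P: "partition_on C P" and kh: "\<And>x. x \<in> C \<Longrightarrow> k (h x) = x" for h k C P
  proof -
    have "k ` h ` X = X" if "X \<in> P" for X
    proof -
      have "X \<subseteq> C" using P that by (auto simp: partition_on_def)
      then have "(\<lambda>x. k (h x)) ` X = (\<lambda>x. x) ` X" using kh by (intro image_cong) auto
      then show ?thesis by (simp add: image_image)
    qed
    then have "(\<lambda>X. k ` h ` X) ` P = (\<lambda>X. X) ` P" by (intro image_cong) auto
    then show ?thesis by (simp only: image_image image_ident)
  qed
  have "(`) g ` (`) f ` P = P" if "partition_on A P" for P by (rule id[OF that]) (rule g(2))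
  moreover have "(`) f ` (`) g ` P = P" if "partition_on B P" for P by (rule id[OF that]) (rule g(3))
  ultimately show ?thesis
    by (intro bij_betw_byWitness[where f' = "(`) ((`) g)"])
      (use img[OF f] img[OF g(1)] in auto)
qed

lemma sum_partitions_eq_card:
  assumes fin: "finite A" and card: "card A = card B" "finite B"
  shows "(\<Sum>P | partition_on A P. F (card P) * (\<Prod>X\<in>P. v (card X))) =
    (\<Sum>P | partition_on B P. F (card P) * (\<Prod>X\<in>P. v (card X)))"
proof -
  obtain f where f: "bij_betw f A B" using finite_same_card_bij[OF fin card(2,1)] by auto
  have inj: "inj_on f A" using f by (rule bij_betw_imp_inj_on)
  have "(\<Sum>P | partition_on A P. F (card P) * (\<Prod>X\<in>P. v (card X))) =
      (\<Sum>P | partition_on A P. F (card ((`) f ` P)) * (\<Prod>X\<in>(`) f ` P. v (card X)))"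
  proof (rule sum.cong[OF refl])
    fix P assume "P \<in> {P. partition_on A P}"
    then have P: "P \<subseteq> Pow A" by (auto simp: partition_on_def)
    have inj': "inj_on ((`) f) P" using inj_on_subset[OF inj_on_image_Pow[OF inj] P] .
    have "card (f ` X) = card X" if "X \<in> P" for X
      using P that by (intro card_image inj_on_subset[OF inj]) auto
    then show "F (card P) * (\<Prod>X\<in>P. v (card X)) =
        F (card ((`) f ` P)) * (\<Prod>X\<in>(`) f ` P. v (card X))"
      by (simp add: card_image[OF inj'] prod.reindex[OF inj'])
  qed
  also have "\<dots> = (\<Sum>P | partition_on B P. F (card P) * (\<Prod>X\<in>P. v (card X)))"
    by (rule sum.reindex_bij_betw[OF bij_betw_partition_image[OF f]])
  finally show ?thesis .
qed

text \<open>A partition with some blocks selected amounts to a subset \<open>Y\<close> with a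
  partition of it and one of its complement. This turns sums over families of blocks into the
  convolution of exponential generating series.\<close>

lemma sum_partitions_split:
  fixes F G :: "'v set set \<Rightarrow> 'c::comm_semiring_0"
  assumes A: "finite A"
  shows "(\<Sum>P | partition_on A P. \<Sum>Q\<in>Pow P. F Q * G (P - Q)) =
    (\<Sum>Y\<in>Pow A. (\<Sum>Q | partition_on Y Q. F Q) * (\<Sum>Q | partition_on (A - Y) Q. G Q))"
proof -
  have fin: "finite {P. partition_on Y P}" if "Y \<subseteq> A" for Y
    using that A finite_subset by (intro finitely_many_partition_on) auto
  have "(\<Sum>P | partition_on A P. \<Sum>Q\<in>Pow P. F Q * G (P - Q)) =
      (\<Sum>(P, Q)\<in>(SIGMA P:{P. partition_on A P}. Pow P). F Q * G (P - Q))"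
    using fin[of A] finite_elements[OF A] by (intro sum.Sigma) auto
  also have "\<dots> = (\<Sum>(Y, Q, Q')\<in>(SIGMA Y:Pow A. {Q. partition_on Y Q} \<times> {Q. partition_on (A - Y) Q}).
      F Q * G Q')"
  proof (rule sum.reindex_bij_witness[of _ "\<lambda>(Y, Q, Q'). (Q \<union> Q', Q)" "\<lambda>(P, Q). (\<Union>Q, Q, P - Q)"])
    fix x assume "x \<in> (SIGMA P:{P. partition_on A P}. Pow P)"
    then obtain P Q where x: "x = (P, Q)" "partition_on A P" "Q \<subseteq> P" by auto
    have dis: "disjoint P" "\<Union>P = A" "{} \<notin> P" using x by (auto simp: partition_on_def)
    have "\<Union>(P - Q) = A - \<Union>Q" using disjointD[OF dis(1)] dis(2) x(3) by blast
    moreover have "disjoint Q" "disjoint (P - Q)"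
      using x(3) by (auto intro!: disjoint_subset[OF dis(1)])
    ultimately show "(case x of (P, Q) \<Rightarrow> (\<Union>Q, Q, P - Q)) \<in>
        (SIGMA Y:Pow A. {Q. partition_on Y Q} \<times> {Q. partition_on (A - Y) Q})"
      using x dis by (auto simp: partition_on_def)
    show "(case case x of (P, Q) \<Rightarrow> (\<Union>Q, Q, P - Q) of (Y, Q, Q') \<Rightarrow> (Q \<union> Q', Q)) = x"
      using x by auto
    show "(case case x of (P, Q) \<Rightarrow> (\<Union>Q, Q, P - Q) of (Y, Q, Q') \<Rightarrow> F Q * G Q') =
        (case x of (P, Q) \<Rightarrow> F Q * G (P - Q))" using x by auto
  next
    fix y assume "y \<in> (SIGMA Y:Pow A. {Q. partition_on Y Q} \<times> {Q. partition_on (A - Y) Q})"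
    then obtain Y Q Q' where y: "y = (Y, Q, Q')" "Y \<subseteq> A" "partition_on Y Q" "partition_on (A - Y) Q'"
      by auto
    have U: "\<Union>Q = Y" "\<Union>Q' = A - Y" "{} \<notin> Q" "{} \<notin> Q'" "disjoint Q" "disjoint Q'"
      using y by (auto simp: partition_on_def)
    have "Q \<inter> Q' = {}"
    proof (rule ccontr)
      assume "Q \<inter> Q' \<noteq> {}"
      then obtain X where X: "X \<in> Q" "X \<in> Q'" by auto
      then have "X \<subseteq> Y" "X \<subseteq> A - Y" using U(1,2) by auto
      then have "X = {}" by auto
      then show False using X U(3) by simp
    qed
    then have "Q \<union> Q' - Q = Q'" by auto
    then show "(case case y of (Y, Q, Q') \<Rightarrow> (Q \<union> Q', Q) of (P, Q) \<Rightarrow> (\<Union>Q, Q, P - Q)) = y"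
      using y U by simp
    have "disjoint (Q \<union> Q')"
      by (rule disjoint_union) (use U in auto)
    moreover have "\<Union>(Q \<union> Q') = A" using U y(2) by auto
    ultimately show "(case y of (Y, Q, Q') \<Rightarrow> (Q \<union> Q', Q)) \<in> (SIGMA P:{P. partition_on A P}. Pow P)"
      using y U by (simp add: partition_on_def)
  qed
  also have "\<dots> = (\<Sum>Y\<in>Pow A. \<Sum>(Q, Q')\<in>{Q. partition_on Y Q} \<times> {Q. partition_on (A - Y) Q}. F Q * G Q')"
    using A fin by (subst sum.Sigma) (auto simp: split_def)
  finally show ?thesis by (simp add: sum_product sum.cartesian_product)
qed

section \<open>Weighted sums over hypertrees\<close>

text \<open>Each weight carries one inverse factor \<open>t\<close>, and the right-hand side has two
  of them; this is the origin of the \<open>t\<close> in the product formula.\<close>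

lemma weight_add: "weight (m + n) = t * weight m * weight n"
proof -
  have "int (m + n) - 1 = 1 + (int m - 1) + (int n - 1)" by simp
  moreover have "t \<noteq> 0" by simp
  ultimately show ?thesis
    by (simp only: weight_def power_int_add simp_thms power_int_1_right)
qed

lemma weight_pos: "m > 0 \<Longrightarrow> weight m = t ^ (m - 1)"
  by (simp only: weight_def power_int_def) (simp add: nat_diff_distrib)

lemma weight_0: "weight 0 = 1 / t"
proof -
  have "int 0 - 1 = - 1" by simp
  then show ?thesis by (simp only: weight_def power_int_minus power_int_1_right inverse_eq_divide)
qed

text \<open>With \<open>w i\<close> the number of structures on a set of \<open>i\<close> elements,
  this is the total weight of all decorations of \<open>E\<close>.\<close>

definition edge_weight :: "(nat \<Rightarrow> nat) \<Rightarrow> 'v set set \<Rightarrow> rat fls" where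
  "edge_weight w E = (\<Prod>e\<in>E. of_nat (w (card e))) * weight (card E)"

text \<open>\<open>Suc\<close> accounts for the parent missing from the block, equivalently for the
  extra point of the differential.\<close>

definition block_weight :: "(nat \<Rightarrow> nat) \<Rightarrow> 'v set set \<Rightarrow> rat fls" where
  "block_weight w P = (\<Prod>B\<in>P. of_nat (w (Suc (card B))))"

lemma card_tree_edges:
  assumes "finite A" "partition_on A P" "p \<in> acyclic_maps P R"
  shows "card (tree_edges P p) = card P"
  unfolding tree_edges_def
  using partition_on_finiteD[OF assms(1,2)] by (intro card_image inj_on_tree_edge[OF _ _ assms(3)])

lemma edge_weight_tree_edges:
  assumes "finite A" "partition_on A P" "p \<in> acyclic_maps P R"
  shows "edge_weight w (tree_edges P p) = block_weight w P * weight (card P)"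
proof -
  note P = partition_on_finiteD[OF assms(1,2)]
  have "(\<Prod>e\<in>tree_edges P p. of_nat (w (card e))) = (\<Prod>B\<in>P. of_nat (w (card (insert (p B) B))) :: rat fls)"
    unfolding tree_edges_def using prod.reindex[OF inj_on_tree_edge[OF P(2,3) assms(3)]] by simp
  also have "\<dots> = block_weight w P"
    unfolding block_weight_def
    using P parent_notin_block[OF assms(3)] by (intro prod.cong) simp_all
  finally show ?thesis
    unfolding edge_weight_def card_tree_edges[OF assms] by simp
qed

lemma finite_hypertrees: "finite V \<Longrightarrow> finite (hypertrees V)"
  by (rule finite_subset[of _ "Pow (Pow V)"])
    (auto simp: hypertrees_def dest: hypertree_edge_subset)

lemma sum_hypertrees:
  fixes f :: "'v set set \<Rightarrow> 'c::comm_monoid_add"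
  assumes V: "finite V" "r \<in> V"
  shows "(\<Sum>E\<in>hypertrees V. f E) =
    (\<Sum>P | partition_on (V - {r}) P. \<Sum>p\<in>acyclic_maps P {r}. f (tree_edges P p))"
proof -
  have A: "finite (V - {r})" using V by simp
  have "(\<Sum>E\<in>hypertrees V. f E) =
      (\<Sum>(P, p)\<in>(SIGMA P:{P. partition_on (V - {r}) P}. acyclic_maps P {r}). f (tree_edges P p))"
    using sum.reindex_bij_betw[OF bij_betw_tree_edges[OF V], of f] by (simp add: split_def)
  also have "\<dots> = (\<Sum>P | partition_on (V - {r}) P. \<Sum>p\<in>acyclic_maps P {r}. f (tree_edges P p))"
  proof (rule sum.Sigma[symmetric])
    show "finite {P. partition_on (V - {r}) P}" by (rule finitely_many_partition_on[OF A])
    show "\<forall>P\<in>{P. partition_on (V - {r}) P}. finite (acyclic_maps P {r})"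
      using partition_on_finiteD[OF A] by (simp add: finite_acyclic_maps)
  qed
  finally show ?thesis .
qed

text \<open>Weight and decorations depend on the partition alone, so the acyclic maps contribute
  only their number. The factor \<open>g\<close> is \<open>1\<close> for plain hypertrees and the
  number of incidences for edge-pointed rooted ones.\<close>

lemma sum_hypertrees_edge_weight:
  assumes V: "finite V" "r \<in> V"
  shows "(\<Sum>E\<in>hypertrees V. edge_weight w E * g (card E)) =
    (\<Sum>P | partition_on (V - {r}) P.
      block_weight w P * weight (card P) * of_nat (card V ^ (card P - 1)) * g (card P))"
  unfolding sum_hypertrees[OF V]
proof (rule sum.cong[OF refl])
  have A: "finite (V - {r})" using V by simp
  have cV: "Suc (card (V - {r})) = card V" using V by (rule card_Suc_Diff1)
  fix P assume "P \<in> {P. partition_on (V - {r}) P}"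
  then have P: "partition_on (V - {r}) P" by simp
  have "(\<Sum>p\<in>acyclic_maps P {r}. edge_weight w (tree_edges P p) * g (card (tree_edges P p))) =
      (\<Sum>p\<in>acyclic_maps P {r}. block_weight w P * weight (card P) * g (card P))"
    by (rule sum.cong[OF refl])
      (simp only: edge_weight_tree_edges[OF A P] card_tree_edges[OF A P])
  also have "\<dots> = block_weight w P * weight (card P) * of_nat (card V ^ (card P - 1)) * g (card P)"
    using card_acyclic_maps_single_root[OF A P, of r] by (simp only: cV sum_constant) simp
  finally show "(\<Sum>p\<in>acyclic_maps P {r}. edge_weight w (tree_edges P p) * g (card (tree_edges P p))) =
      block_weight w P * weight (card P) * of_nat (card V ^ (card P - 1)) * g (card P)" .
qed

lemma hypertree_sum_card_edges:
  assumes "hypertree V E"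
  shows "(\<Sum>e\<in>E. card e) + 1 = card V + card E"
proof -
  obtain r where r: "r \<in> V" using assms by (auto simp: hypertree_def)
  have V: "finite V" using hypertree_finite[OF assms] .
  have A: "finite (V - {r})" using V by simp
  obtain P p where P: "partition_on (V - {r}) P" and p: "p \<in> acyclic_maps P {r}"
    and E: "tree_edges P p = E"
    using hypertree_as_tree_edges[OF assms r] by blast
  note P' = partition_on_finiteD[OF A P]
  have "(\<Sum>e\<in>E. card e) = (\<Sum>B\<in>P. card (insert (p B) B))"
    unfolding E[symmetric] tree_edges_def
    using sum.reindex[OF inj_on_tree_edge[OF P'(2,3) p]] by simp
  also have "\<dots> = (\<Sum>B\<in>P. card B + 1)"
    using P' parent_notin_block[OF p] by (intro sum.cong) simp_all
  also have "\<dots> = card (V - {r}) + card P"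
    using product_partition[OF P P'(5)] by (simp only: sum.distrib) simp
  also have "card P = card E" using card_tree_edges[OF A P p] E by simp
  finally show ?thesis using card_Suc_Diff1[OF V r] by simp
qed

section \<open>Hollow hypertrees\<close>

lemma finite_hollow_hypertrees: "finite A \<Longrightarrow> finite (hollow_hypertrees g A)"
  by (rule finite_subset[OF _ finite_hypertrees[of "insert g A"]])
    (auto simp: hollow_hypertrees_def hypertrees_def)

lemma ex1_image_iff:
  assumes "inj_on f A"
  shows "(\<exists>!y. y \<in> f ` A \<and> Q y) \<longleftrightarrow> (\<exists>!x. x \<in> A \<and> Q (f x))"
proof
  assume "\<exists>!y. y \<in> f ` A \<and> Q y"
  then obtain x where x: "x \<in> A" "Q (f x)" "\<And>y. y \<in> f ` A \<and> Q y \<Longrightarrow> y = f x" by auto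
  show "\<exists>!x. x \<in> A \<and> Q (f x)"
  proof (rule ex1I[of _ x])
    fix x' assume x': "x' \<in> A \<and> Q (f x')"
    then have "f x' = f x" using x(3) by blast
    then show "x' = x" using inj_onD[OF assms] x x' by blast
  qed (use x in blast)
next
  assume "\<exists>!x. x \<in> A \<and> Q (f x)"
  then obtain x where "x \<in> A" "Q (f x)" "\<And>x'. x' \<in> A \<and> Q (f x') \<Longrightarrow> x' = x" by auto
  then show "\<exists>!y. y \<in> f ` A \<and> Q y" by (intro ex1I[of _ "f x"]) blast+
qed

text \<open>These maps are the fibres over the one-element first layers \<open>{B}\<close>: with a
  single root, \<open>B\<close> has no choice, and it becomes the root set of all other
  blocks.\<close>

lemma card_acyclic_maps_unique_child:
  assumes A: "finite A" and P: "partition_on A P" and r: "r \<notin> A"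
  shows "card {p \<in> acyclic_maps P {r}. \<exists>!B. B \<in> P \<and> p B = r} = hollow_count P"
proof -
  note P' = partition_on_finiteD[OF A P]
  have fin: "finite (acyclic_maps P {r})" using P' by (simp add: finite_acyclic_maps)
  have "{p \<in> acyclic_maps P {r}. \<exists>!B. B \<in> P \<and> p B = r} =
      (\<Union>B\<in>P. {p \<in> acyclic_maps P {r}. {C \<in> P. p C \<in> {r}} = {B}})"
  proof (intro set_eqI iffI)
    fix p assume "p \<in> {p \<in> acyclic_maps P {r}. \<exists>!B. B \<in> P \<and> p B = r}"
    then obtain B where B: "p \<in> acyclic_maps P {r}" "B \<in> P" "p B = r"
      "\<And>C. C \<in> P \<and> p C = r \<Longrightarrow> C = B" by auto
    then have "{C \<in> P. p C \<in> {r}} = {B}" by blast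
    then show "p \<in> (\<Union>B\<in>P. {p \<in> acyclic_maps P {r}. {C \<in> P. p C \<in> {r}} = {B}})"
      using B(1,2) by blast
  next
    fix p assume "p \<in> (\<Union>B\<in>P. {p \<in> acyclic_maps P {r}. {C \<in> P. p C \<in> {r}} = {B}})"
    then obtain B where B: "p \<in> acyclic_maps P {r}" "{C \<in> P. p C \<in> {r}} = {B}" by blast
    then have "\<exists>!B. B \<in> P \<and> p B = r" by (intro ex1I[of _ B]) blast+
    then show "p \<in> {p \<in> acyclic_maps P {r}. \<exists>!B. B \<in> P \<and> p B = r}" using B(1) by simp
  qed
  then have "card {p \<in> acyclic_maps P {r}. \<exists>!B. B \<in> P \<and> p B = r} =
      (\<Sum>B\<in>P. card {p \<in> acyclic_maps P {r}. {C \<in> P. p C \<in> {r}} = {B}})"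
    using fin P'(1) by (subst card_UN_disjoint[symmetric]) auto
  also have "\<dots> = hollow_count P"
    unfolding hollow_count_def
  proof (rule sum.cong[OF refl])
    fix B assume "B \<in> P"
    then show "card {p \<in> acyclic_maps P {r}. {C \<in> P. p C \<in> {r}} = {B}} = card (acyclic_maps (P - {B}) B)"
      by (subst card_acyclic_maps_layer) (use P' r in auto)
  qed
  finally show ?thesis .
qed

text \<open>The root \<open>r\<close> lies in no block, so an edge contains the gap exactly when its
  block has parent \<open>r\<close>.\<close>

lemma sum_hollow_hypertrees_edge_weight:
  assumes A: "finite A" and r: "r \<notin> A"
  shows "(\<Sum>E\<in>hollow_hypertrees r A. edge_weight w E) =
    (\<Sum>P | partition_on A P. block_weight w P * weight (card P) * of_nat (hollow_count P))"
proof -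
  define V where "V = insert r A"
  have V: "finite V" "r \<in> V" "V - {r} = A" using A r by (auto simp: V_def)
  let ?H = "\<lambda>E. \<exists>!e. e \<in> E \<and> r \<in> e"
  have "hollow_hypertrees r A = {E \<in> hypertrees V. ?H E}"
    by (auto simp: hollow_hypertrees_def hypertrees_def V_def)
  then have "(\<Sum>E\<in>hollow_hypertrees r A. edge_weight w E) =
      (\<Sum>E\<in>hypertrees V. if ?H E then edge_weight w E else 0)"
    using finite_hypertrees[OF V(1)] by (simp only: sum.inter_filter)
  also have "\<dots> = (\<Sum>P | partition_on A P. \<Sum>p\<in>acyclic_maps P {r}.
      if ?H (tree_edges P p) then edge_weight w (tree_edges P p) else 0)"
    using sum_hypertrees[OF V(1,2)] V(3) by simp
  also have "\<dots> = (\<Sum>P | partition_on A P. block_weight w P * weight (card P) * of_nat (hollow_count P))"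
  proof (rule sum.cong[OF refl])
    fix P assume "P \<in> {P. partition_on A P}"
    then have P: "partition_on A P" by simp
    note P' = partition_on_finiteD[OF A P]
    have fin: "finite (acyclic_maps P {r})" using P' by (simp add: finite_acyclic_maps)
    have H: "?H (tree_edges P p) \<longleftrightarrow> (\<exists>!B. B \<in> P \<and> p B = r)" if p: "p \<in> acyclic_maps P {r}" for p
    proof -
      have "r \<in> insert (p B) B \<longleftrightarrow> p B = r" if "B \<in> P" for B using P'(4) r that by auto
      then have "(\<exists>!B. B \<in> P \<and> p B = r) \<longleftrightarrow> (\<exists>!B. B \<in> P \<and> r \<in> insert (p B) B)" by metis
      then show ?thesis
        using ex1_image_iff[OF inj_on_tree_edge[OF P'(2,3) p], of "\<lambda>e. r \<in> e"]
        unfolding tree_edges_def by simp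
    qed
    have "(\<Sum>p\<in>acyclic_maps P {r}. if ?H (tree_edges P p) then edge_weight w (tree_edges P p) else 0) =
        (\<Sum>p\<in>acyclic_maps P {r}. if \<exists>!B. B \<in> P \<and> p B = r then block_weight w P * weight (card P) else 0)"
      by (rule sum.cong[OF refl]) (simp only: H edge_weight_tree_edges[OF A P])
    also have "\<dots> = (\<Sum>p | p \<in> acyclic_maps P {r} \<and> (\<exists>!B. B \<in> P \<and> p B = r). block_weight w P * weight (card P))"
      using fin by (simp only: sum.inter_filter)
    also have "\<dots> = block_weight w P * weight (card P) * of_nat (hollow_count P)"
      by (simp only: sum_constant card_acyclic_maps_unique_child[OF A P r] mult.commute)
    finally show "(\<Sum>p\<in>acyclic_maps P {r}. if ?H (tree_edges P p) then edge_weight w (tree_edges P p) else 0) =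
        block_weight w P * weight (card P) * of_nat (hollow_count P)" .
  qed
  finally show ?thesis .
qed

text \<open>The convolution produces hypertrees on arbitrary subsets, whereas the series use
  \<open>{1..n}\<close>. Hypertrees are not transported: both sides become partition sums, and only
  partitions are relabelled.\<close>

lemma sum_hypertrees_eq_card:
  fixes V W :: "'v set"
  assumes "finite V" "finite W" "card V = card W"
  shows "(\<Sum>E\<in>hypertrees V. edge_weight w E) = (\<Sum>E\<in>hypertrees W. edge_weight w E)"
proof (cases "V = {}")
  case True
  then show ?thesis using assms by simp
next
  case False
  then have "W \<noteq> {}" using assms by auto
  with False obtain r s where r: "r \<in> V" "s \<in> W" by blast
  have "(\<Sum>E\<in>hypertrees V. edge_weight w E) = (\<Sum>P | partition_on (V - {r}) P.
      weight (card P) * of_nat (card W ^ (card P - 1)) * (\<Prod>B\<in>P. of_nat (w (Suc (card B)))))"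
    using sum_hypertrees_edge_weight[OF assms(1) r(1), of w "\<lambda>_. 1"] assms(3)
    by (simp add: block_weight_def mult_ac)
  also have "\<dots> = (\<Sum>P | partition_on (W - {s}) P.
      weight (card P) * of_nat (card W ^ (card P - 1)) * (\<Prod>B\<in>P. of_nat (w (Suc (card B)))))"
    using assms r by (intro sum_partitions_eq_card) simp_all
  also have "\<dots> = (\<Sum>E\<in>hypertrees W. edge_weight w E)"
    using sum_hypertrees_edge_weight[OF assms(2) r(2), of w "\<lambda>_. 1"]
    by (simp add: block_weight_def mult_ac)
  finally show ?thesis .
qed

lemma sum_hollow_hypertrees_eq_card:
  fixes A B :: "'v set"
  assumes A: "finite A" "r \<notin> A" and B: "finite B" "s \<notin> B" and card: "card A = card B"
  shows "(\<Sum>E\<in>hollow_hypertrees r A. edge_weight w E) = (\<Sum>E\<in>hollow_hypertrees s B. edge_weight w E)"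
proof -
  define F where "F = (\<lambda>k. weight k * of_nat (if k = 0 then 0 else card B ^ (k - 1)))"
  have eq: "(\<Sum>E\<in>hollow_hypertrees r A. edge_weight w E) =
      (\<Sum>P | partition_on A P. F (card P) * (\<Prod>X\<in>P. of_nat (w (Suc (card X)))))"
    if A: "finite A" "r \<notin> A" and card: "card A = card B" for r and A :: "'v set"
    unfolding sum_hollow_hypertrees_edge_weight[OF A]
  proof (rule sum.cong[OF refl])
    fix P assume "P \<in> {P. partition_on A P}"
    then have P: "partition_on A P" by simp
    show "block_weight w P * weight (card P) * of_nat (hollow_count P) =
        F (card P) * (\<Prod>X\<in>P. of_nat (w (Suc (card X))))"
      using finite_elements[OF A(1) P]
      by (simp add: hollow_count_eq[OF A(1) P] F_def block_weight_def card mult_ac)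
  qed
  show ?thesis
    unfolding eq[OF A card] eq[OF B refl] using A B card by (intro sum_partitions_eq_card) simp_all
qed

text \<open>The factor \<open>card V\<close> is the choice of a root. For the root \<open>r\<close>,
  the pointed edge with all that hangs beyond it is a hollow hypertree with gap \<open>r\<close> on
  \<open>Y\<close>, and the rest is a hypertree on \<open>V - Y\<close>. The proof compares both
  sides numerically, partition by partition, through \<open>hollow_convolution\<close>.\<close>

lemma edge_pointed_rooted_convolution:
  fixes V :: "'v set"
  assumes V: "finite V" "r \<in> V"
  shows "(\<Sum>E\<in>hypertrees V. edge_weight w E * of_nat (\<Sum>e\<in>E. card e)) =
    of_nat (card V) * (\<Sum>Y\<in>Pow (V - {r}). t *
      (\<Sum>E\<in>hollow_hypertrees r Y. edge_weight w E) * (\<Sum>E\<in>hypertrees (V - Y). edge_weight w E))"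
proof -
  define A where "A = V - {r}"
  have A: "finite A" "r \<notin> A" and cV: "card V = Suc (card A)"
    using V card_Suc_Diff1[OF V] by (simp_all add: A_def del: card_Diff_insert)
  \<comment> \<open>The factor \<open>t\<close> sits in \<open>F\<close> so that the weights of
    \<open>Q\<close> and \<open>P - Q\<close> multiply to that of \<open>P\<close>.\<close>
  define F where "F = (\<lambda>Q :: 'v set set. t * (block_weight w Q * weight (card Q) * of_nat (hollow_count Q)))"
  define G where "G = (\<lambda>Q :: 'v set set. block_weight w Q * weight (card Q) * of_nat (card (acyclic_maps Q {r})))"
  have "(\<Sum>E\<in>hypertrees V. edge_weight w E * of_nat (\<Sum>e\<in>E. card e)) =
      (\<Sum>E\<in>hypertrees V. edge_weight w E * of_nat (card A + card E))"
  proof (rule sum.cong[OF refl])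
    fix E assume "E \<in> hypertrees V"
    then have "(\<Sum>e\<in>E. card e) + 1 = card V + card E"
      by (intro hypertree_sum_card_edges) (simp add: hypertrees_def)
    then have "(\<Sum>e\<in>E. card e) = card A + card E" by (simp add: cV)
    then show "edge_weight w E * of_nat (\<Sum>e\<in>E. card e) = edge_weight w E * of_nat (card A + card E)"
      by (simp only:)
  qed
  also have "\<dots> = (\<Sum>P | partition_on A P. block_weight w P * weight (card P) *
      of_nat (card V ^ (card P - 1)) * of_nat (card A + card P))"
    using sum_hypertrees_edge_weight[OF V, of w "\<lambda>k. of_nat (card A + k)"] by (simp only: A_def)
  also have "\<dots> = (\<Sum>P | partition_on A P. of_nat (card V) * (\<Sum>Q\<in>Pow P. F Q * G (P - Q)))"
  proof (rule sum.cong[OF refl])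
    fix P assume "P \<in> {P. partition_on A P}"
    then have P: "partition_on A P" by simp
    note P' = partition_on_finiteD[OF A(1) P]
    have FG: "F Q * G (P - Q) = block_weight w P * weight (card P) *
        of_nat (hollow_count Q * card (acyclic_maps (P - Q) {r}))" if "Q \<in> Pow P" for Q
    proof -
      have Q: "Q \<subseteq> P" "finite Q" "finite (P - Q)" using that P'(1) finite_subset by auto
      have "card P = card Q + card (P - Q)"
        using Q P'(1) by (simp add: card_Diff_subset card_mono)
      then have "weight (card P) = t * weight (card Q) * weight (card (P - Q))"
        by (simp only: weight_add)
      moreover have "block_weight w P = block_weight w Q * block_weight w (P - Q)"
        unfolding block_weight_def using prod.subset_diff[OF Q(1) P'(1)] by (simp add: mult.commute)
      ultimately show ?thesis by (simp add: F_def G_def mult_ac)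
    qed
    have "of_nat (card V) * (\<Sum>Q\<in>Pow P. F Q * G (P - Q)) = of_nat (card V) * (\<Sum>Q\<in>Pow P.
        block_weight w P * weight (card P) * of_nat (hollow_count Q * card (acyclic_maps (P - Q) {r})))"
      using FG by (simp only: cong: sum.cong)
    also have "\<dots> = block_weight w P * weight (card P) *
        of_nat (card V * (\<Sum>Q\<in>Pow P. hollow_count Q * card (acyclic_maps (P - Q) {r})))"
      unfolding sum_distrib_left[symmetric] of_nat_mult of_nat_sum by (rule mult.left_commute)
    also have "\<dots> = block_weight w P * weight (card P) *
        of_nat ((card A + card P) * card (acyclic_maps P {r}))"
      using hollow_convolution[OF A(1) P A(2)] by (simp only: cV)
    also have "\<dots> = block_weight w P * weight (card P) *
      of_nat (card V ^ (card P - 1)) * of_nat (card A + card P)"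
      by (simp only: card_acyclic_maps_single_root[OF A(1) P A(2)] cV of_nat_mult mult_ac)
    finally show "block_weight w P * weight (card P) * of_nat (card V ^ (card P - 1)) *
        of_nat (card A + card P) = of_nat (card V) * (\<Sum>Q\<in>Pow P. F Q * G (P - Q))"
      by (rule sym)
  qed
  also have "\<dots> = of_nat (card V) * (\<Sum>Y\<in>Pow A.
      (\<Sum>Q | partition_on Y Q. F Q) * (\<Sum>Q | partition_on (A - Y) Q. G Q))"
    by (simp only: sum_distrib_left[symmetric] sum_partitions_split[OF A(1)])
  also have "(\<Sum>Y\<in>Pow A. (\<Sum>Q | partition_on Y Q. F Q) * (\<Sum>Q | partition_on (A - Y) Q. G Q)) =
      (\<Sum>Y\<in>Pow A. t * (\<Sum>E\<in>hollow_hypertrees r Y. edge_weight w E) *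
        (\<Sum>E\<in>hypertrees (V - Y). edge_weight w E))"
  proof (rule sum.cong[OF refl])
    fix Y assume "Y \<in> Pow A"
    then have Y: "finite Y" "r \<notin> Y" using A finite_subset by auto
    have VY: "finite (V - Y)" "r \<in> V - Y" "V - Y - {r} = A - Y" using V Y by (auto simp: A_def)
    have "(\<Sum>Q | partition_on Y Q. F Q) = t * (\<Sum>E\<in>hollow_hypertrees r Y. edge_weight w E)"
      unfolding sum_hollow_hypertrees_edge_weight[OF Y] F_def by (simp only: sum_distrib_left)
    moreover have "(\<Sum>Q | partition_on (A - Y) Q. G Q) = (\<Sum>E\<in>hypertrees (V - Y). edge_weight w E)"
    proof -
      have "(\<Sum>E\<in>hypertrees (V - Y). edge_weight w E) = (\<Sum>Q | partition_on (A - Y) Q.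
          \<Sum>p\<in>acyclic_maps Q {r}. edge_weight w (tree_edges Q p))"
        using sum_hypertrees[OF VY(1,2)] VY(3) by simp
      also have "\<dots> = (\<Sum>Q | partition_on (A - Y) Q. G Q)"
      proof (rule sum.cong[OF refl])
        fix Q assume "Q \<in> {Q. partition_on (A - Y) Q}"
        then have Q: "partition_on (A - Y) Q" by simp
        have "(\<Sum>p\<in>acyclic_maps Q {r}. edge_weight w (tree_edges Q p)) =
            (\<Sum>p\<in>acyclic_maps Q {r}. block_weight w Q * weight (card Q))"
          by (rule sum.cong[OF refl]) (simp only: edge_weight_tree_edges[OF finite_Diff[OF A(1)] Q])
        then show "(\<Sum>p\<in>acyclic_maps Q {r}. edge_weight w (tree_edges Q p)) = G Q"
          by (simp only: G_def sum_constant mult.commute)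
      qed
      finally show ?thesis by (rule sym)
    qed
    ultimately show "(\<Sum>Q | partition_on Y Q. F Q) * (\<Sum>Q | partition_on (A - Y) Q. G Q) =
        t * (\<Sum>E\<in>hollow_hypertrees r Y. edge_weight w E) *
        (\<Sum>E\<in>hypertrees (V - Y). edge_weight w E)" by (simp only:)
  qed
  finally show ?thesis by (simp only: A_def)
qed

section \<open>Generating series\<close>

lemma hypertree_finite_edges:
  assumes "hypertree V E"
  shows "finite E" "e \<in> E \<Longrightarrow> finite e"
proof -
  have "E \<subseteq> Pow V" using hypertree_edge_subset[OF assms] by blast
  then show "finite E" "e \<in> E \<Longrightarrow> finite e"
    using hypertree_finite[OF assms] by (auto intro: finite_subset)
qed

lemma finite_pointed_hypertrees:
  assumes "finite V"
  shows "finite (rooted_hypertrees V)" "finite (edge_pointed_hypertrees V)"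
    "finite (edge_pointed_rooted_hypertrees V)"
proof -
  have "rooted_hypertrees V = hypertrees V \<times> V"
    by (auto simp: rooted_hypertrees_def hypertrees_def)
  then show "finite (rooted_hypertrees V)" by (simp only: finite_cartesian_product finite_hypertrees assms)
  have edges: "finite E" "\<And>e. e \<in> E \<Longrightarrow> finite e" if "E \<in> hypertrees V" for E
    using that hypertree_finite_edges by (auto simp: hypertrees_def)
  have "edge_pointed_hypertrees V = (SIGMA E:hypertrees V. E)"
    by (auto simp: edge_pointed_hypertrees_def hypertrees_def)
  then show "finite (edge_pointed_hypertrees V)"
    using edges by (simp add: finite_SigmaI finite_hypertrees[OF assms])
  have "edge_pointed_rooted_hypertrees V = (SIGMA E:hypertrees V. SIGMA e:E. e)"
    by (auto simp: edge_pointed_rooted_hypertrees_def hypertrees_def)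
  then show "finite (edge_pointed_rooted_hypertrees V)"
    using edges by (simp add: finite_SigmaI finite_hypertrees[OF assms])
qed

lemma hypertree_underlying:
  "E \<in> hypertrees V \<Longrightarrow> hypertree V (id E)"
  "h \<in> rooted_hypertrees V \<Longrightarrow> hypertree V (fst h)"
  "h' \<in> edge_pointed_hypertrees V \<Longrightarrow> hypertree V (fst h')"
  "h'' \<in> edge_pointed_rooted_hypertrees V \<Longrightarrow> hypertree V (fst h'')"
  "E \<in> hollow_hypertrees g V \<Longrightarrow> hypertree (insert g V) (id E)"
  by (auto simp: hypertrees_def rooted_hypertrees_def edge_pointed_hypertrees_def
      edge_pointed_rooted_hypertrees_def hollow_hypertrees_def)

text \<open>Only the numbers of structures enter, without transport maps. Both a species and a
  family of bases of a linear species fit here.\<close>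

locale sized_family =
  fixes S :: "nat set \<Rightarrow> 'a set" and w :: "nat \<Rightarrow> nat"
  assumes finite_structures: "finite e \<Longrightarrow> finite (S e)"
    and card_structures: "finite e \<Longrightarrow> card (S e) = w (card e)"
begin

lemma sum_decorated:
  assumes X: "finite X" and ed: "\<And>h. h \<in> X \<Longrightarrow> finite (ed h)"
    "\<And>h e. h \<in> X \<Longrightarrow> e \<in> ed h \<Longrightarrow> finite e"
  shows "(\<Sum>(h, d)\<in>decorated S ed X. weight (card (ed h))) = (\<Sum>h\<in>X. edge_weight w (ed h))"
proof -
  have "(\<Sum>(h, d)\<in>decorated S ed X. weight (card (ed h))) =
      (\<Sum>h\<in>X. \<Sum>d\<in>PiE (ed h) S. weight (card (ed h)))"
    unfolding decorated_def
    by (rule sum.Sigma[symmetric]) (use X ed finite_structures in \<open>auto intro!: finite_PiE\<close>)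
  also have "\<dots> = (\<Sum>h\<in>X. edge_weight w (ed h))"
  proof (rule sum.cong[OF refl])
    fix h assume h: "h \<in> X"
    have "card (PiE (ed h) S) = (\<Prod>e\<in>ed h. w (card e))"
      unfolding card_PiE[OF ed(1)[OF h]] using ed(2)[OF h] card_structures by (intro prod.cong) auto
    then show "(\<Sum>d\<in>PiE (ed h) S. weight (card (ed h))) = edge_weight w (ed h)"
      by (simp only: sum_constant edge_weight_def of_nat_prod)
  qed
  finally show ?thesis .
qed

lemma E_num_eq: "E_num S k m = (\<Sum>P\<in>set_partitions k m. \<Prod>B\<in>P. w (Suc (card B)))"
proof -
  have fin: "finite P" "B \<in> P \<Longrightarrow> finite B" if "P \<in> set_partitions k m" for P B
    using partition_on_finiteD[of "{1..m}" P] that by (auto simp: set_partitions_def)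
  have card: "card (differential S B) = w (Suc (card B))" "finite (differential S B)" if "finite B" for B
    using that card_structures[of "insert 0 (Suc ` B)"] finite_structures[of "insert 0 (Suc ` B)"]
    by (simp_all add: differential_def card_image)
  have "finite (set_partitions k m)"
    using finitely_many_partition_on[of "{1..m}"] by (simp add: set_partitions_def)
  then have "E_num S k m = (\<Sum>P\<in>set_partitions k m. card (PiE P (differential S)))"
    unfolding E_num_def decorated_def id_def using fin card
    by (intro card_SigmaI) (auto intro!: finite_PiE)
  also have "\<dots> = (\<Sum>P\<in>set_partitions k m. \<Prod>B\<in>P. w (Suc (card B)))"
    using fin card by (intro sum.cong refl) (simp add: card_PiE)
  finally show ?thesis .
qed

text \<open>A structure of the differential on a point is a structure on two points, so the
  convention for this value is a condition on the species.\<close>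

lemma E_num_1_1: "E_num S 1 1 = w 2"
proof -
  have "set_partitions 1 1 = {{{1}}}"
  proof (intro set_eqI iffI)
    fix P assume "P \<in> set_partitions 1 1"
    then have P: "partition_on {1} P" "card P = 1" by (simp_all add: set_partitions_def)
    then obtain B where "P = {B}" by (auto simp: card_1_singleton_iff)
    then show "P \<in> {{{1}}}" using P by (simp add: partition_on_def)
  qed (simp add: set_partitions_def partition_on_space)
  then show ?thesis by (simp add: E_num_eq numeral_2_eq_2)
qed

lemma sum_block_weight:
  assumes m: "m \<ge> 1"
  shows "(\<Sum>P | partition_on {1..m} P. block_weight w P * g (card P)) =
    (\<Sum>k = 1..m. of_nat (E_num S k m) * g k)"
proof -
  have range: "card ` {P. partition_on {1..m} P} \<subseteq> {1..m}"
  proof clarify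
    fix P assume P: "partition_on {1..m} P"
    note P' = partition_on_finiteD[OF _ P, simplified]
    have "P \<noteq> {}" using P'(4) m by auto
    then have "card P \<ge> 1" using P'(1) by (simp add: Suc_le_eq card_gt_0_iff)
    have "card P = (\<Sum>B\<in>P. 1)" by simp
    also have "\<dots> \<le> (\<Sum>B\<in>P. card B)"
      using P'(3,5) by (intro sum_mono) (metis One_nat_def Suc_leI card_gt_0_iff)
    also have "\<dots> = m" using product_partition[OF P P'(5)] by simp
    finally show "card P \<in> {1..m}" using \<open>card P \<ge> 1\<close> by simp
  qed
  have "(\<Sum>P | partition_on {1..m} P. block_weight w P * g (card P)) =
      (\<Sum>k = 1..m. \<Sum>P | P \<in> {P. partition_on {1..m} P} \<and> card P = k. block_weight w P * g (card P))"
    by (rule sum.group[symmetric, OF _ _ range]) (simp_all add: finitely_many_partition_on)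
  also have "\<dots> = (\<Sum>k = 1..m. of_nat (E_num S k m) * g k)"
  proof (rule sum.cong[OF refl])
    fix k
    have "(\<Sum>P | P \<in> {P. partition_on {1..m} P} \<and> card P = k. block_weight w P * g (card P)) =
        (\<Sum>P\<in>set_partitions k m. block_weight w P * g k)"
      by (rule sum.cong) (auto simp: set_partitions_def)
    also have "\<dots> = of_nat (E_num S k m) * g k"
      by (simp only: E_num_eq block_weight_def of_nat_sum of_nat_prod sum_distrib_right)
    finally show "(\<Sum>P | P \<in> {P. partition_on {1..m} P} \<and> card P = k. block_weight w P * g (card P)) =
        of_nat (E_num S k m) * g k" .
  qed
  finally show ?thesis .
qed

definition hyp_sum :: "nat \<Rightarrow> rat fls" where
  "hyp_sum n = (\<Sum>E\<in>hypertrees {1..n}. edge_weight w E)"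

definition hollow_sum :: "nat \<Rightarrow> rat fls" where
  "hollow_sum n = (\<Sum>E\<in>hollow_hypertrees 0 {1..n}. edge_weight w E)"

lemma hyp_sum_0: "hyp_sum 0 = 0"
proof -
  have "hypertrees {1..0::nat} = {}" by (auto simp: hypertrees_def hypertree_def)
  then show ?thesis by (simp add: hyp_sum_def)
qed

lemma hyp_sum_1: "hyp_sum 1 = 1 / t"
proof -
  have "hyp_sum 1 = (\<Sum>P | partition_on ({1..1} - {1::nat}) P.
      block_weight w P * weight (card P) * of_nat (card {1..1::nat} ^ (card P - 1)) * 1)"
    using sum_hypertrees_edge_weight[of "{1..1::nat}" 1 w "\<lambda>_. 1"] by (simp add: hyp_sum_def)
  also have "{P. partition_on ({1..1} - {1::nat}) P} = {{}}" by (auto simp: partition_on_empty)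
  finally show ?thesis by (simp add: block_weight_def weight_0)
qed

lemma hyp_sum_eq:
  assumes n: "n \<ge> 2"
  shows "hyp_sum n = (\<Sum>k = 1..n - 1. of_nat (E_num S k (n - 1)) * (of_nat n * t) ^ (k - 1))"
proof -
  \<comment> \<open>Rooting at the largest label leaves exactly the set whose partitions
    \<open>E_num S k (n - 1)\<close> counts.\<close>
  have A: "{1..n} - {n} = {1..n - 1}" using n by auto
  have "hyp_sum n = (\<Sum>P | partition_on {1..n - 1} P.
      block_weight w P * weight (card P) * of_nat (n ^ (card P - 1)) * 1)"
    using sum_hypertrees_edge_weight[of "{1..n}" n w "\<lambda>_. 1"] n
    unfolding hyp_sum_def A by simp
  also have "\<dots> = (\<Sum>P | partition_on {1..n - 1} P.
      block_weight w P * (weight (card P) * of_nat (n ^ (card P - 1))))"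
    by (simp only: mult.assoc mult_1_right)
  also have "\<dots> = (\<Sum>k = 1..n - 1. of_nat (E_num S k (n - 1)) * (weight k * of_nat (n ^ (k - 1))))"
    using n by (intro sum_block_weight[where g = "\<lambda>k. weight k * of_nat (n ^ (k - 1))"]) simp
  also have "\<dots> = (\<Sum>k = 1..n - 1. of_nat (E_num S k (n - 1)) * (of_nat n * t) ^ (k - 1))"
    by (rule sum.cong[OF refl]) (simp only: atLeastAtMost_iff weight_pos Suc_le_eq One_nat_def
        power_mult_distrib of_nat_power mult.commute)
  finally show ?thesis .
qed

lemma hollow_sum_0: "hollow_sum 0 = 0"
proof -
  have "hollow_hypertrees 0 {1..0::nat} = {}"
  proof (intro equals0I)
    fix E assume "E \<in> hollow_hypertrees 0 {1..0::nat}"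
    then obtain e where "hypertree {0::nat} E" "e \<in> E" by (auto simp: hollow_hypertrees_def)
    then have "e \<subseteq> {0}" "2 \<le> card e" by (auto simp: hypertree_def hypergraph_def)
    then show False using card_mono[of "{0::nat}" e] by simp
  qed
  then show ?thesis by (simp add: hollow_sum_def)
qed

lemma hollow_sum_eq:
  assumes n: "n \<ge> 1"
  shows "hollow_sum n = (\<Sum>k = 1..n. of_nat (E_num S k n) * (of_nat n * t) ^ (k - 1))"
proof -
  have "hollow_sum n = (\<Sum>P | partition_on {1..n} P.
      block_weight w P * weight (card P) * of_nat (hollow_count P))"
    unfolding hollow_sum_def by (rule sum_hollow_hypertrees_edge_weight) auto
  also have "\<dots> = (\<Sum>P | partition_on {1..n} P.
      block_weight w P * (weight (card P) * of_nat (n ^ (card P - 1))))"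
  proof (rule sum.cong[OF refl])
    fix P assume "P \<in> {P. partition_on {1..n} P}"
    then have P: "partition_on {1..n} P" by simp
    have "P \<noteq> {}" using P n by (auto simp: partition_on_def)
    then have "hollow_count P = n ^ (card P - 1)" using hollow_count_eq[OF _ P] by simp
    then show "block_weight w P * weight (card P) * of_nat (hollow_count P) =
        block_weight w P * (weight (card P) * of_nat (n ^ (card P - 1)))"
      by (simp only: mult.assoc)
  qed
  also have "\<dots> = (\<Sum>k = 1..n. of_nat (E_num S k n) * (weight k * of_nat (n ^ (k - 1))))"
    using n by (intro sum_block_weight[where g = "\<lambda>k. weight k * of_nat (n ^ (k - 1))"]) simp
  also have "\<dots> = (\<Sum>k = 1..n. of_nat (E_num S k n) * (of_nat n * t) ^ (k - 1))"
    by (rule sum.cong[OF refl]) (simp only: atLeastAtMost_iff weight_pos Suc_le_eq One_nat_def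
        power_mult_distrib of_nat_power mult.commute)
  finally show ?thesis .
qed

lemma weighted_egf_nth:
  assumes "finite (X n)" "\<And>h. h \<in> X n \<Longrightarrow> \<exists>V. hypertree V (ed h)"
  shows "fps_nth (weighted_egf S ed X) n = (\<Sum>h\<in>X n. edge_weight w (ed h)) / fact n"
proof -
  have "(\<Sum>(h, d)\<in>decorated S ed (X n). weight (card (ed h))) = (\<Sum>h\<in>X n. edge_weight w (ed h))"
    by (rule sum_decorated[OF assms(1)]) (use assms(2) hypertree_finite_edges in blast)+
  then show ?thesis by (simp add: weighted_egf_def)
qed

lemma ser_hyp_nth: "fps_nth (ser_hyp S) n = hyp_sum n / fact n"
  unfolding ser_hyp_def hyp_sum_def
proof (rule trans[OF weighted_egf_nth])
  show "finite (hypertrees {1..n})" by (rule finite_hypertrees) simp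
qed (auto simp: hypertrees_def)

lemma ser_h_nth: "fps_nth (ser_h S) n = hollow_sum n / fact n"
  unfolding ser_h_def hollow_sum_def
proof (rule trans[OF weighted_egf_nth])
  show "finite (hollow_hypertrees 0 {1..n})" by (rule finite_hollow_hypertrees) simp
qed (auto simp: hollow_hypertrees_def)

lemma ser_r_nth: "fps_nth (ser_r S) n = of_nat n * hyp_sum n / fact n"
proof -
  have eq: "rooted_hypertrees {1..n} = hypertrees {1..n} \<times> {1..n}"
    by (auto simp: rooted_hypertrees_def hypertrees_def)
  have "(\<Sum>h\<in>rooted_hypertrees {1..n}. edge_weight w (fst h)) =
      (\<Sum>E\<in>hypertrees {1..n}. \<Sum>r\<in>{1..n}. edge_weight w E)"
    unfolding eq sum.cartesian_product by (simp add: split_def)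
  also have "\<dots> = of_nat n * hyp_sum n"
    by (simp add: hyp_sum_def sum_distrib_left)
  finally show ?thesis
    unfolding ser_r_def
  proof (subst weighted_egf_nth)
    show "finite (rooted_hypertrees {1..n})"
      by (simp add: finite_pointed_hypertrees)
  qed (auto simp: rooted_hypertrees_def)
qed

lemma ser_e_nth: "fps_nth (ser_e S) n =
  (\<Sum>E\<in>hypertrees {1..n}. edge_weight w E * of_nat (card E)) / fact n"
proof -
  have eq: "edge_pointed_hypertrees {1..n} = (SIGMA E:hypertrees {1..n}. E)"
    by (auto simp: edge_pointed_hypertrees_def hypertrees_def)
  have fin: "finite E" if "E \<in> hypertrees {1..n}" for E
    using that hypertree_finite_edges(1) by (auto simp: hypertrees_def)
  have "(\<Sum>h\<in>edge_pointed_hypertrees {1..n}. edge_weight w (fst h)) =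
      (\<Sum>E\<in>hypertrees {1..n}. \<Sum>e\<in>E. edge_weight w E)"
    unfolding eq using fin by (subst sum.Sigma) (auto simp: split_def finite_hypertrees)
  also have "\<dots> = (\<Sum>E\<in>hypertrees {1..n}. edge_weight w E * of_nat (card E))"
    by (simp add: mult.commute)
  finally show ?thesis
    unfolding ser_e_def using fin
  proof (subst weighted_egf_nth)
    show "finite (edge_pointed_hypertrees {1..n})"
      by (simp add: finite_pointed_hypertrees)
  qed (auto simp: edge_pointed_hypertrees_def)
qed

lemma ser_re_nth: "fps_nth (ser_re S) n =
  (\<Sum>E\<in>hypertrees {1..n}. edge_weight w E * of_nat (\<Sum>e\<in>E. card e)) / fact n"
proof -
  have eq: "edge_pointed_rooted_hypertrees {1..n} = (SIGMA E:hypertrees {1..n}. SIGMA e:E. e)"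
    by (auto simp: edge_pointed_rooted_hypertrees_def hypertrees_def)
  have fin: "finite E" "\<And>e. e \<in> E \<Longrightarrow> finite e" if "E \<in> hypertrees {1..n}" for E
    using that hypertree_finite_edges by (auto simp: hypertrees_def)
  have "(\<Sum>h\<in>edge_pointed_rooted_hypertrees {1..n}. edge_weight w (fst h)) =
      (\<Sum>E\<in>hypertrees {1..n}. \<Sum>x\<in>(SIGMA e:E. e). edge_weight w E)"
    unfolding eq using fin
    by (subst sum.Sigma) (auto simp: split_def finite_hypertrees intro!: finite_SigmaI)
  also have "\<dots> = (\<Sum>E\<in>hypertrees {1..n}. edge_weight w E * of_nat (\<Sum>e\<in>E. card e))"
  proof (rule sum.cong[OF refl])
    fix E assume "E \<in> hypertrees {1..n}"
    then have "card (SIGMA e:E. e) = (\<Sum>e\<in>E. card e)" using fin by (intro card_SigmaI) auto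
    then show "(\<Sum>x\<in>(SIGMA e:E. e). edge_weight w E) = edge_weight w E * of_nat (\<Sum>e\<in>E. card e)"
      by (simp only: sum_constant mult.commute)
  qed
  finally show ?thesis
    unfolding ser_re_def using fin
  proof (subst weighted_egf_nth)
    show "finite (edge_pointed_rooted_hypertrees {1..n})"
      by (simp add: finite_pointed_hypertrees)
  qed (auto simp: edge_pointed_rooted_hypertrees_def)
qed

end

section \<open>Relations between the series and their closed forms\<close>

lemma sum_Pow_card:
  fixes f :: "nat \<Rightarrow> 'c::comm_semiring_1"
  assumes "finite A"
  shows "(\<Sum>Y\<in>Pow A. f (card Y)) = (\<Sum>j\<le>card A. of_nat (card A choose j) * f j)"
proof -
  have "(\<Sum>Y\<in>Pow A. f (card Y)) = (\<Sum>j\<le>card A. \<Sum>Y | Y \<in> Pow A \<and> card Y = j. f (card Y))"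
    by (rule sum.group[symmetric]) (use assms in \<open>auto intro: card_mono\<close>)
  also have "\<dots> = (\<Sum>j\<le>card A. of_nat (card A choose j) * f j)"
  proof (rule sum.cong[OF refl])
    fix j
    have "(\<Sum>Y | Y \<in> Pow A \<and> card Y = j. f (card Y)) = (\<Sum>Y | Y \<subseteq> A \<and> card Y = j. f j)"
      by (rule sum.cong) auto
    then show "(\<Sum>Y | Y \<in> Pow A \<and> card Y = j. f (card Y)) = of_nat (card A choose j) * f j"
      by (simp only: sum_constant n_subsets[OF assms])
  qed
  finally show ?thesis .
qed

context sized_family
begin

lemma edge_pointed_rooted_sum:
  assumes n: "n \<ge> 1"
  shows "(\<Sum>E\<in>hypertrees {1..n}. edge_weight w E * of_nat (\<Sum>e\<in>E. card e)) =
    of_nat n * (\<Sum>j\<le>n - 1. of_nat (n - 1 choose j) * (t * hollow_sum j * hyp_sum (n - j)))"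
proof -
  have "(\<Sum>E\<in>hypertrees {1..n}. edge_weight w E * of_nat (\<Sum>e\<in>E. card e)) =
    of_nat (card {1..n}) * (\<Sum>Y\<in>Pow ({1..n} - {n}). t *
      (\<Sum>E\<in>hollow_hypertrees n Y. edge_weight w E) * (\<Sum>E\<in>hypertrees ({1..n} - Y). edge_weight w E))"
    by (rule edge_pointed_rooted_convolution) (use n in simp_all)
  also have "\<dots> = of_nat n * (\<Sum>Y\<in>Pow ({1..n} - {n}). t * hollow_sum (card Y) * hyp_sum (n - card Y))"
  proof -
    have "t * (\<Sum>E\<in>hollow_hypertrees n Y. edge_weight w E) * (\<Sum>E\<in>hypertrees ({1..n} - Y). edge_weight w E) =
        t * hollow_sum (card Y) * hyp_sum (n - card Y)" if "Y \<in> Pow ({1..n} - {n})" for Y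
    proof -
      have Y: "Y \<subseteq> {1..n}" "finite Y" "n \<notin> Y" using that finite_subset[of Y "{1..n}"] by auto
      have "(\<Sum>E\<in>hollow_hypertrees n Y. edge_weight w E) = hollow_sum (card Y)"
        unfolding hollow_sum_def by (rule sum_hollow_hypertrees_eq_card) (use Y in simp_all)
      moreover have "(\<Sum>E\<in>hypertrees ({1..n} - Y). edge_weight w E) = hyp_sum (n - card Y)"
        unfolding hyp_sum_def
        by (rule sum_hypertrees_eq_card) (use Y in \<open>simp_all add: card_Diff_subset\<close>)
      ultimately show ?thesis by (simp only:)
    qed
    then show ?thesis by (simp only: card_atLeastAtMost diff_Suc_1 cong: sum.cong)
  qed
  also have "(\<Sum>Y\<in>Pow ({1..n} - {n}). t * hollow_sum (card Y) * hyp_sum (n - card Y)) =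
      (\<Sum>j\<le>card ({1..n} - {n}). of_nat (card ({1..n} - {n}) choose j) * (t * hollow_sum j * hyp_sum (n - j)))"
    by (rule sum_Pow_card) simp
  also have "card ({1..n} - {n}) = n - 1" using n by (simp add: card_Diff_subset)
  finally show ?thesis .
qed

lemma ser_re_eq: "ser_re S = fps_const t * ser_r S * ser_h S"
proof (rule fps_ext)
  fix n :: nat
  define T where "T = (\<lambda>j. t * hollow_sum j * hyp_sum (n - j))"
  have rhs: "fps_nth (fps_const t * ser_r S * ser_h S) n =
      (\<Sum>j\<le>n. of_nat (n - j) / (fact j * fact (n - j)) * T j)"
  proof -
    have "fps_nth (fps_const t * ser_r S * ser_h S) n =
        (\<Sum>j = 0..n. fps_nth (ser_h S) j * fps_nth (fps_const t * ser_r S) (n - j))"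
      by (simp only: mult.commute[of "fps_const t * ser_r S"] fps_mult_nth)
    also have "\<dots> = (\<Sum>j\<le>n. of_nat (n - j) / (fact j * fact (n - j)) * T j)"
      unfolding atMost_atLeast0
      by (rule sum.cong[OF refl]) (simp add: ser_h_nth ser_r_nth T_def mult_ac)
    finally show ?thesis .
  qed
  show "fps_nth (ser_re S) n = fps_nth (fps_const t * ser_r S * ser_h S) n"
  proof (cases n)
    case 0
    have "hypertrees {1..0::nat} = {}" by (auto simp: hypertrees_def hypertree_def)
    then show ?thesis unfolding rhs using 0 by (simp add: ser_re_nth)
  next
    case (Suc m)
    have "fps_nth (ser_re S) n = of_nat n * (\<Sum>j\<le>m. of_nat (m choose j) * T j) / fact n"
      using edge_pointed_rooted_sum[of n] Suc unfolding ser_re_nth T_def by simp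
    \<comment> \<open>The choice of a root among all \<open>n\<close> vertices, combined with the
      binomial coefficient of \<open>n - 1\<close>, becomes the choice of a root in the part of size
      \<open>n - j\<close>.\<close>
    also have "\<dots> = (\<Sum>j\<le>m. of_nat (n - j) / (fact j * fact (n - j)) * T j)"
      unfolding sum_distrib_left sum_divide_distrib
    proof (rule sum.cong[OF refl])
      fix j assume "j \<in> {..m}"
      then have j: "j \<le> m" by simp
      have nz: "(of_nat k :: rat fls) \<noteq> 0" if "k > 0" for k using that by simp
      have "of_nat n * (of_nat (m choose j) * T j) / fact n =
          of_nat n * (fact m / (fact j * fact (m - j)) * T j) / fact n"
        by (simp only: binomial_fact[OF j])
      also have "\<dots> = of_nat (n - j) / (fact j * fact (n - j)) * T j"
      proof -
        have "(fact n :: rat fls) = of_nat n * fact m" using Suc by simp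
        moreover have "(fact (n - j) :: rat fls) = of_nat (n - j) * fact (m - j)"
          using Suc j by (simp add: Suc_diff_le)
        ultimately show ?thesis using nz[of n] nz[of "n - j"] Suc j
          by (simp only: ) (simp add: divide_simps)
      qed
      finally show "of_nat n * (of_nat (m choose j) * T j) / fact n =
          of_nat (n - j) / (fact j * fact (n - j)) * T j" .
    qed
    \<comment> \<open>The added term \<open>j = n\<close> vanishes through its factor
      \<open>n - j\<close>.\<close>
    also have "\<dots> = (\<Sum>j\<le>n. of_nat (n - j) / (fact j * fact (n - j)) * T j)"
      using Suc by simp
    finally show ?thesis unfolding rhs .
  qed
qed

text \<open>Holds hypertree by hypertree: the number of edges is one plus the number of incidences
  minus the number of vertices.\<close>

lemma ser_e_eq: "ser_e S = ser_hyp S + ser_re S - ser_r S"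
proof (rule fps_ext)
  fix n :: nat
  have "(\<Sum>E\<in>hypertrees {1..n}. edge_weight w E * of_nat (card E)) =
      (\<Sum>E\<in>hypertrees {1..n}. edge_weight w E + edge_weight w E * of_nat (\<Sum>e\<in>E. card e) -
        of_nat n * edge_weight w E)"
  proof (rule sum.cong[OF refl])
    fix E assume "E \<in> hypertrees {1..n}"
    then have "(\<Sum>e\<in>E. card e) + 1 = n + card E"
      using hypertree_sum_card_edges[of "{1..n}" E] by (simp add: hypertrees_def)
    then have "of_nat (\<Sum>e\<in>E. card e) + 1 = (of_nat n + of_nat (card E) :: rat fls)"
      by (metis of_nat_1 of_nat_add)
    then have "(of_nat (card E) :: rat fls) = of_nat (\<Sum>e\<in>E. card e) + 1 - of_nat n"
      by (simp only: add_diff_cancel_left')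
    then show "edge_weight w E * of_nat (card E) = edge_weight w E +
        edge_weight w E * of_nat (\<Sum>e\<in>E. card e) - of_nat n * edge_weight w E"
      by (simp only:) (simp add: algebra_simps)
  qed
  also have "\<dots> = hyp_sum n + (\<Sum>E\<in>hypertrees {1..n}. edge_weight w E * of_nat (\<Sum>e\<in>E. card e)) -
      of_nat n * hyp_sum n"
    by (simp only: sum.distrib sum_subtractf sum_distrib_left hyp_sum_def)
  finally show "fps_nth (ser_e S) n = fps_nth (ser_hyp S + ser_re S - ser_r S) n"
    by (simp only: ser_e_nth ser_hyp_nth ser_r_nth ser_re_nth fps_add_nth fps_sub_nth
        add_divide_distrib diff_divide_distrib)
qed

lemma ser_hyp_eq: "ser_hyp S = fps_const (1 / t) * fps_X
  + Abs_fps (\<lambda>n. if 2 \<le> n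
      then (\<Sum>k = 1..n - 1. of_nat (E_num S k (n - 1)) * (of_nat n * t) ^ (k - 1)) / fact n else 0)"
proof (rule fps_ext)
  fix n :: nat
  consider "n = 0" | "n = 1" | "n \<ge> 2" by linarith
  then show "fps_nth (ser_hyp S) n = fps_nth (fps_const (1 / t) * fps_X
    + Abs_fps (\<lambda>n. if 2 \<le> n
      then (\<Sum>k = 1..n - 1. of_nat (E_num S k (n - 1)) * (of_nat n * t) ^ (k - 1)) / fact n else 0)) n"
  proof cases
    case 1
    then show ?thesis by (simp add: ser_hyp_nth hyp_sum_0)
  next
    case 2
    then show ?thesis using hyp_sum_1 by (simp add: ser_hyp_nth)
  next
    case 3
    then show ?thesis unfolding ser_hyp_nth hyp_sum_eq[OF 3] by simp
  qed
qed

lemma ser_r_eq: "ser_r S = fps_const (1 / t) * fps_X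
  + fps_const (1 / t) * Abs_fps (\<lambda>n. if 2 \<le> n
      then (\<Sum>k = 1..n - 1. of_nat (E_num S k (n - 1)) * (of_nat n * t) ^ k) / fact n else 0)"
proof (rule fps_ext)
  fix n :: nat
  consider "n = 0" | "n = 1" | "n \<ge> 2" by linarith
  then show "fps_nth (ser_r S) n = fps_nth (fps_const (1 / t) * fps_X
    + fps_const (1 / t) * Abs_fps (\<lambda>n. if 2 \<le> n
      then (\<Sum>k = 1..n - 1. of_nat (E_num S k (n - 1)) * (of_nat n * t) ^ k) / fact n else 0)) n"
  proof cases
    case 1
    then show ?thesis by (simp add: ser_r_nth)
  next
    case 2
    then show ?thesis using hyp_sum_1 by (simp add: ser_r_nth)
  next
    case 3
    have "of_nat n * hyp_sum n = 1 / t * (\<Sum>k = 1..n - 1. of_nat (E_num S k (n - 1)) * (of_nat n * t) ^ k)"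
      unfolding hyp_sum_eq[OF 3] sum_distrib_left
    proof (rule sum.cong[OF refl])
      fix k assume "k \<in> {1..n - 1}"
      then have pow: "(of_nat n * t) ^ k = of_nat n * t * (of_nat n * t) ^ (k - 1)"
        by (cases k) simp_all
      have "a * (c * x) = 1 / y * (c * (a * y * x))" if "y \<noteq> 0" for a c x y :: "rat fls"
        using that by (simp add: field_simps)
      from this[OF fls_X_nonzero] show "of_nat n * (of_nat (E_num S k (n - 1)) * (of_nat n * t) ^ (k - 1)) =
          1 / t * (of_nat (E_num S k (n - 1)) * (of_nat n * t) ^ k)"
        unfolding pow .
    qed
    then have "fps_nth (ser_r S) n = 1 / t *
        ((\<Sum>k = 1..n - 1. of_nat (E_num S k (n - 1)) * (of_nat n * t) ^ k) / fact n)"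
      by (simp only: ser_r_nth times_divide_eq_right)
    then show ?thesis using 3 by (simp only: fps_add_nth fps_mult_left_const_nth fps_X_nth
        fps_nth_Abs_fps) simp
  qed
qed

lemma ser_h_eq: "ser_h S = Abs_fps (\<lambda>n. if 1 \<le> n
  then (\<Sum>k = 1..n. of_nat (E_num S k n) * (of_nat n * t) ^ (k - 1)) / fact n else 0)"
proof (rule fps_ext)
  fix n :: nat
  show "fps_nth (ser_h S) n = fps_nth (Abs_fps (\<lambda>n. if 1 \<le> n
      then (\<Sum>k = 1..n. of_nat (E_num S k n) * (of_nat n * t) ^ (k - 1)) / fact n else 0)) n"
    unfolding ser_h_nth fps_nth_Abs_fps using hollow_sum_0 hollow_sum_eq[of n] by (cases "n = 0") simp_all
qed

end

section \<open>Species and linear species as families counted by size\<close>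

lemma (in species) card_structures_eq:
  assumes I: "finite I" and J: "finite J" and card: "card I = card J"
  shows "card (S I) = card (S J)"
proof -
  have le: "card (S I) \<le> card (S J)" if IJ: "finite I" "finite J" "card I = card J" for I J
  proof -
    obtain \<sigma> where \<sigma>: "bij_betw \<sigma> I J" using finite_same_card_bij[OF IJ] by blast
    then have inj: "inj_on \<sigma> I" and img: "\<sigma> ` I = J" by (simp_all add: bij_betw_def)
    define \<tau> where "\<tau> = inv_into I \<sigma>"
    have inj': "inj_on \<tau> (\<sigma> ` I)" unfolding \<tau>_def by (rule inj_on_inv_into) simp
    have cancel: "tr (\<sigma> ` I) \<tau> (tr I \<sigma> x) = x" if x: "x \<in> S I" for x
    proof -
      have "tr (\<sigma> ` I) \<tau> (tr I \<sigma> x) = tr I (\<tau> \<circ> \<sigma>) x" using tr_comp[OF IJ(1) inj inj' x] by simp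
      also have "\<dots> = tr I id x"
        by (rule tr_cong[OF IJ(1) _ _ x]) (use inj in \<open>auto simp: \<tau>_def inj_on_def\<close>)
      also have "\<dots> = x" by (rule tr_id[OF IJ(1) x])
      finally show ?thesis .
    qed
    have "inj_on (tr I \<sigma>) (S I)" by (rule inj_on_inverseI) (rule cancel)
    moreover have "tr I \<sigma> ` S I \<subseteq> S J" using tr_closed[OF IJ(1) inj] img by auto
    ultimately show ?thesis using finite_structures[OF IJ(2)] by (rule card_inj_on_le)
  qed
  show ?thesis using le[OF I J card] le[OF J I card[symmetric]] by simp
qed

text \<open>Transport along a bijection has a right inverse, so it carries a basis to a spanning
  set; exchanging the two sets gives the other inequality.\<close>

lemma (in linear_species) dim_structures_eq:
  assumes I: "finite I" and J: "finite J" and card: "card I = card J"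
  shows "dim (S I) = dim (S J)"
proof -
  have le: "dim (S J) \<le> dim (S I)" if IJ: "finite I" "finite J" "card I = card J" for I J
  proof -
    obtain \<sigma> where \<sigma>: "bij_betw \<sigma> J I" using finite_same_card_bij[OF IJ(2,1) IJ(3)[symmetric]] by blast
    then have inj: "inj_on \<sigma> J" and img: "\<sigma> ` J = I" by (simp_all add: bij_betw_def)
    define \<tau> where "\<tau> = inv_into J \<sigma>"
    have inj': "inj_on \<tau> I" unfolding \<tau>_def img[symmetric] by (rule inj_on_inv_into) simp
    have img': "\<tau> ` I = J" unfolding \<tau>_def img[symmetric] using inj by (simp add: inv_into_image_cancel)
    have cancel: "tr I \<tau> (tr J \<sigma> x) = x" if x: "x \<in> S J" for x
    proof -
      have "tr I \<tau> (tr J \<sigma> x) = tr J (\<tau> \<circ> \<sigma>) x"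
        using tr_comp[OF IJ(2) inj _ x, of \<tau>] inj' img by simp
      also have "\<dots> = tr J id x"
        by (rule tr_cong[OF IJ(2) _ _ x]) (use inj in \<open>auto simp: \<tau>_def inj_on_def\<close>)
      also have "\<dots> = x" by (rule tr_id[OF IJ(2) x])
      finally show ?thesis .
    qed
    obtain B0 where B0: "finite B0" "span B0 = S I" using finite_dim[OF IJ(1)] by blast
    obtain B where B: "B \<subseteq> S I" "independent B" "S I \<subseteq> span B" "card B = dim (S I)"
      using basis_exists by blast
    have fB: "finite B" using independent_span_bound[OF B0(1) B(2)] B(1) B0(2) by simp
    have sI: "subspace (S I)" using B0(2) subspace_span[of B0] by simp
    \<comment> \<open>The induction also tracks membership in \<open>S I\<close>, because
      \<open>tr\<close> is linear only there.\<close>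
    have lin: "x \<in> S I \<and> tr I \<tau> x \<in> span (tr I \<tau> ` B)" if "x \<in> span B" for x
      using that
    proof (induction rule: span_induct)
      case base
      have 0: "0 \<in> S I" by (rule subspace_0[OF sI])
      have "tr I \<tau> (scale 0 0) = scale 0 (tr I \<tau> 0)" by (rule tr_scale[OF IJ(1) inj' 0])
      then have z: "tr I \<tau> 0 = 0" by simp
      show ?case
      proof (rule subspaceI; unfold mem_Collect_eq)
        show "0 \<in> S I \<and> tr I \<tau> 0 \<in> span (tr I \<tau> ` B)" using 0 z span_zero by simp
      next
        fix x y assume "x \<in> S I \<and> tr I \<tau> x \<in> span (tr I \<tau> ` B)" "y \<in> S I \<and> tr I \<tau> y \<in> span (tr I \<tau> ` B)"
        then show "x + y \<in> S I \<and> tr I \<tau> (x + y) \<in> span (tr I \<tau> ` B)"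
          using tr_add[OF IJ(1) inj', of x y] subspace_add[OF sI] span_add by simp
      next
        fix c x assume "x \<in> S I \<and> tr I \<tau> x \<in> span (tr I \<tau> ` B)"
        then show "scale c x \<in> S I \<and> tr I \<tau> (scale c x) \<in> span (tr I \<tau> ` B)"
          using tr_scale[OF IJ(1) inj', of x c] subspace_scale[OF sI] span_scale by simp
      qed
    next
      case (step x)
      then show ?case using B(1) span_base by blast
    qed
    have "S J \<subseteq> span (tr I \<tau> ` B)"
    proof
      fix x assume x: "x \<in> S J"
      have "tr J \<sigma> x \<in> S I" using tr_closed[OF IJ(2) inj x] img by simp
      then have "tr I \<tau> (tr J \<sigma> x) \<in> span (tr I \<tau> ` B)" using lin B(3) by blast
      then show "x \<in> span (tr I \<tau> ` B)" by (simp only: cancel[OF x])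
    qed
    then have "dim (S J) \<le> card (tr I \<tau> ` B)" by (rule dim_le_card) (simp add: fB)
    also have "\<dots> \<le> card B" by (rule card_image_le[OF fB])
    finally show ?thesis by (simp only: B(4))
  qed
  show ?thesis using le[OF I J card] le[OF J I card[symmetric]] by simp
qed

lemma (in linear_species) exists_bases:
  obtains B where "\<And>e. finite e \<Longrightarrow> finite (B e)" "\<And>e. finite e \<Longrightarrow> independent (B e)"
    "\<And>e. finite e \<Longrightarrow> span (B e) = S e"
proof -
  have "\<exists>B. finite B \<and> independent B \<and> span B = S e" if e: "finite e" for e
  proof -
    obtain B0 where B0: "finite B0" "span B0 = S e" using finite_dim[OF e] by blast
    obtain B where B: "B \<subseteq> B0" "independent B" "B0 \<subseteq> span B"
      using maximal_independent_subset by blast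
    have "span B = S e"
      using span_mono[OF B(1)] span_minimal[OF B(3) subspace_span] unfolding B0(2)
      by (rule equalityI)
    then show ?thesis using B(2) finite_subset[OF B(1) B0(1)] by blast
  qed
  then obtain B where "\<And>e. finite e \<Longrightarrow> finite (B e) \<and> independent (B e) \<and> span (B e) = S e" by metis
  then show ?thesis using that by blast
qed

text \<open>The component with \<open>m\<close> edges has as dimension the number of basis
  decorations of hypertrees with \<open>m\<close> edges; regrouping by \<open>m\<close> gives the
  series of \<open>B\<close> as a family of sets.\<close>

lemma (in vector_space) weighted_egf_lin_eq:
  assumes X: "\<And>n. finite (X n)" "\<And>n h. h \<in> X n \<Longrightarrow> \<exists>V. hypertree V (ed h)"
    and B: "\<And>e. finite e \<Longrightarrow> finite (B e)" "\<And>e. finite e \<Longrightarrow> independent (B e)"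
      "\<And>e. finite e \<Longrightarrow> span (B e) = S e"
  shows "weighted_egf_lin scale S ed X = weighted_egf B ed X"
proof (rule fps_ext)
  fix n
  have fin: "finite (ed h)" "\<And>e. e \<in> ed h \<Longrightarrow> finite e" if h: "h \<in> X n" for h
    using X(2)[OF h] hypertree_finite_edges by blast+
  have dim: "decorated_dim scale S ed {h \<in> X n. card (ed h) = m} =
      (\<Sum>h | h \<in> X n \<and> card (ed h) = m. card (PiE (ed h) B))" for m
  proof -
    have "decorated_dim scale S ed {h \<in> X n. card (ed h) = m} =
        card (decorated B ed {h \<in> X n. card (ed h) = m})"
    proof (rule decorated_dim_eq_card)
      fix h e assume "h \<in> {h \<in> X n. card (ed h) = m}" "e \<in> ed h"
      then have "finite e" using fin(2) by blast
      then show "independent (B e)" "span (B e) = S e" "finite (B e)" by (fact B)+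
    qed (use X(1)[of n] fin(1) in simp_all)
    also have "\<dots> = (\<Sum>h | h \<in> X n \<and> card (ed h) = m. card (PiE (ed h) B))"
      unfolding decorated_def using X(1)[of n] fin B(1)
      by (intro card_SigmaI) (auto intro!: finite_PiE)
    finally show ?thesis .
  qed
  have "(\<Sum>(h, d)\<in>decorated B ed (X n). weight (card (ed h))) =
      (\<Sum>h\<in>X n. \<Sum>d\<in>PiE (ed h) B. weight (card (ed h)))"
    unfolding decorated_def using X(1)[of n] fin B(1)
    by (intro sum.Sigma[symmetric]) (auto intro!: finite_PiE)
  also have "\<dots> = (\<Sum>m\<in>(\<lambda>h. card (ed h)) ` X n. \<Sum>h | h \<in> X n \<and> card (ed h) = m.
      \<Sum>d\<in>PiE (ed h) B. weight (card (ed h)))"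
    by (rule sum.image_gen[OF X(1)])
  also have "\<dots> = (\<Sum>m\<in>(\<lambda>h. card (ed h)) ` X n.
      of_nat (decorated_dim scale S ed {h \<in> X n. card (ed h) = m}) * weight m)"
    unfolding dim of_nat_sum sum_distrib_right by (intro sum.cong refl) simp
  finally show "fps_nth (weighted_egf_lin scale S ed X) n = fps_nth (weighted_egf B ed X) n"
    by (simp only: weighted_egf_lin_def weighted_egf_def fps_nth_Abs_fps)
qed

lemma (in vector_space) E_dim_eq_E_num:
  assumes B: "\<And>e. finite e \<Longrightarrow> finite (B e)" "\<And>e. finite e \<Longrightarrow> independent (B e)"
      "\<And>e. finite e \<Longrightarrow> span (B e) = S e"
  shows "E_dim scale S k n = E_num B k n"
  unfolding E_dim_def E_num_def
proof (rule decorated_dim_eq_card)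
  show "finite (set_partitions k n)"
    using finitely_many_partition_on[of "{1..n}"] by (simp add: set_partitions_def)
  fix P assume "P \<in> set_partitions k n"
  then have P: "partition_on {1..n} P" by (simp add: set_partitions_def)
  note P' = partition_on_finiteD[OF finite_atLeastAtMost P]
  show "finite (id P)" using P'(1) by simp
  fix e assume "e \<in> id P"
  then have "finite (insert 0 (Suc ` e))" using P'(5) by simp
  then show "independent (differential B e)" "span (differential B e) = differential S e"
    "finite (differential B e)"
    unfolding differential_def by (fact B)+
qed

theorem theorem2p8:
  fixes S :: "nat set \<Rightarrow> 'a set" and tr :: "nat set \<Rightarrow> (nat \<Rightarrow> nat) \<Rightarrow> 'a \<Rightarrow> 'a"
    and scale :: "'k::field \<Rightarrow> 'b::ab_group_add \<Rightarrow> 'b"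
    and L :: "nat set \<Rightarrow> 'b set" and ltr :: "nat set \<Rightarrow> (nat \<Rightarrow> nat) \<Rightarrow> 'b \<Rightarrow> 'b"
  shows
    "(species S tr \<longrightarrow>
       ser_r S = fps_const (1 / t) * fps_X
          + fps_const (1 / t) * Abs_fps (\<lambda>n. if 2 \<le> n
              then (\<Sum>k = 1..n - 1. of_nat (E_num S k (n - 1)) * (of_nat n * t) ^ k) / fact n else 0) \<and>
       ser_h S = Abs_fps (\<lambda>n. if 1 \<le> n
              then (\<Sum>k = 1..n. of_nat (E_num S k n) * (of_nat n * t) ^ (k - 1)) / fact n else 0) \<and>
       ser_hyp S = fps_const (1 / t) * fps_X
          + Abs_fps (\<lambda>n. if 2 \<le> n
              then (\<Sum>k = 1..n - 1. of_nat (E_num S k (n - 1)) * (of_nat n * t) ^ (k - 1)) / fact n else 0) \<and>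
       ser_re S = fps_const t * ser_r S * ser_h S \<and>
       ser_e S = ser_hyp S + ser_re S - ser_r S \<and>
       (E_num S 1 1 = 1 \<longleftrightarrow> card (S {1, 2}) = 1))
     \<and>
     (linear_species scale L ltr \<longrightarrow>
       lin_ser_r scale L = fps_const (1 / t) * fps_X
          + fps_const (1 / t) * Abs_fps (\<lambda>n. if 2 \<le> n
              then (\<Sum>k = 1..n - 1. of_nat (E_dim scale L k (n - 1)) * (of_nat n * t) ^ k) / fact n else 0) \<and>
       lin_ser_h scale L = Abs_fps (\<lambda>n. if 1 \<le> n
              then (\<Sum>k = 1..n. of_nat (E_dim scale L k n) * (of_nat n * t) ^ (k - 1)) / fact n else 0) \<and>
       lin_ser_hyp scale L = fps_const (1 / t) * fps_X
          + Abs_fps (\<lambda>n. if 2 \<le> n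
              then (\<Sum>k = 1..n - 1. of_nat (E_dim scale L k (n - 1)) * (of_nat n * t) ^ (k - 1)) / fact n else 0) \<and>
       lin_ser_re scale L = fps_const t * lin_ser_r scale L * lin_ser_h scale L \<and>
       lin_ser_e scale L = lin_ser_hyp scale L + lin_ser_re scale L - lin_ser_r scale L \<and>
       (E_dim scale L 1 1 = 1 \<longleftrightarrow> vector_space.dim scale (L {1, 2}) = 1))"
proof ((rule conjI; rule impI), goal_cases)
  case 1
  then interpret species S tr .
  interpret sized_family S "\<lambda>k. card (S {1..k})"
    by unfold_locales (rule finite_structures, assumption, rule card_structures_eq, simp_all)
  have "{1..2} = {1, 2::nat}" by auto
  then have "E_num S 1 1 = card (S {1, 2})" using E_num_1_1 by simp
  then have "E_num S 1 1 = 1 \<longleftrightarrow> card (S {1, 2}) = 1" by (rule arg_cong)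
  then show ?case
    by (intro conjI ser_r_eq ser_h_eq ser_hyp_eq ser_re_eq ser_e_eq)
next
  case 2
  then interpret linear_species scale L ltr .
  obtain B where B: "\<And>e. finite e \<Longrightarrow> finite (B e)" "\<And>e. finite e \<Longrightarrow> independent (B e)"
    "\<And>e. finite e \<Longrightarrow> span (B e) = L e"
    using exists_bases by blast
  have card_B: "card (B e) = dim (L e)" if "finite e" for e
    using dim_span_eq_card_independent[OF B(2)[OF that]] B(3)[OF that] by simp
  interpret sized_family B "\<lambda>k. dim (L {1..k})"
  proof
    show "card (B e) = dim (L {1..card e})" if "finite e" for e
      unfolding card_B[OF that] by (rule dim_structures_eq[OF that]) simp_all
  qed (rule B(1))
  have lin: "lin_ser_hyp scale L = ser_hyp B" "lin_ser_r scale L = ser_r B" "lin_ser_e scale L = ser_e B"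
    "lin_ser_re scale L = ser_re B" "lin_ser_h scale L = ser_h B"
    unfolding lin_ser_hyp_def lin_ser_r_def lin_ser_e_def lin_ser_re_def lin_ser_h_def
      ser_hyp_def ser_r_def ser_e_def ser_re_def ser_h_def
    by (rule weighted_egf_lin_eq[OF _ _ B]; (rule finite_hypertrees finite_pointed_hypertrees
          finite_hollow_hypertrees finite_atLeastAtMost exI hypertree_underlying | assumption)+)+
  have E: "E_dim scale L k n = E_num B k n" for k n by (rule E_dim_eq_E_num[OF B])
  have "{1..2} = {1, 2::nat}" by auto
  then have "E_num B 1 1 = dim (L {1, 2})" using E_num_1_1 by simp
  then have "E_num B 1 1 = 1 \<longleftrightarrow> dim (L {1, 2}) = 1" by (rule arg_cong)
  then show ?case
    unfolding lin E
    by (intro conjI ser_r_eq ser_h_eq ser_hyp_eq ser_re_eq ser_e_eq)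
qed

end
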